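(* Let $X^{(1)},\dots,X^{(n)}$ be coalescing skip-free processes on a linearly ordered state space $S$, starting at positions $x_1<x_2<\cdots<x_n$. Let $Z_T(x_i)$ denote the position at time $T$ of the particle that started at $x_i$ (after possible coalescence). Then for all $y_1\le y_2\le\cdots\le y_n$ in $S$, $$\mathbb{P}\bigl(Z_T(x_i)\le y_i\ \text{for all } i=1,\dots,n\bigr)=\det(M^W),$$ where $M^W$ is the $n\times n$ matrix with entries $$M^W_{ij}=F(x_i,y_j)-[\,i<j\,].$$ Here $F(x,y)$ is the probability that a single (non-interacting) particle started at $x$ is at a position $\le y$ at time $T$, and $[\cdot]$ is the Iverson bracket.
   Context: Time $T>0$ is fixed. The state space $S$ is either discrete (e.g. $S\subseteq\mathbb{Z}$), with one-particle transition probabilities $P(x,y)$ from $x$ to $y$ in time $T$ and $F(x,y)=\sum_{z\le y}P(x,z)$, or continuous (e.g. an interval of $\mathbb{R}$), with transition densities $P(x,\cdot)$ and sums replaced by integrals, so $F(x,y)=\int_{z\le y}P(x,z)\,dz$. The one-particle process is a Markov process that is skip-free in the sense of the Karlin–McGregor assumptions: transitions are only to neighbouring states (continuous paths in the continuous case), so that two independent copies cannot change their order without first being at the same point at the same time. No symmetry, homogeneity, or specific transition kernel is assumed. Coalescing processes: each of the $n$ particles performs an independent copy of the skip-free process until it meets another particle; when particles meet they coalesce and continue as one. *)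

theory Defs
  imports "HOL-Probability.Probability" "Jordan_Normal_Form.Determinant"
begin

text \<open>
  The state space is a set \<open>S\<close> of reals with the order of the reals: a countable set in the discrete
  case (every countable linear order embeds into the reals), an interval in the continuous case.
  Time runs through \<open>{0..T}\<close>; a discrete-time chain is covered through its right-continuous
  step path, since transition functions need not be time-homogeneous.
\<close>

text \<open>\<open>\<kappa> s t x\<close> is the law at time \<open>t\<close> of a particle that is at \<open>x\<close> at time \<open>s\<close>.\<close>

definition transition_function ::
  "real \<Rightarrow> real set \<Rightarrow> (real \<Rightarrow> real \<Rightarrow> real \<Rightarrow> real measure) \<Rightarrow> bool" where
  "transition_function T S \<kappa> \<longleftrightarrow>
     (\<forall>t\<in>{0..T}. (\<lambda>(s, x). \<kappa> s t x)
        \<in> restrict_space borel {0..t} \<Otimes>\<^sub>M restrict_space borel S \<rightarrow>\<^sub>M prob_algebra (restrict_space borel S)) \<and>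
     (\<forall>t\<in>{0..T}. \<forall>x\<in>S. \<kappa> t t x = return (restrict_space borel S) x) \<and>
     (\<forall>s\<in>{0..T}. \<forall>t\<in>{s..T}. \<forall>u\<in>{t..T}. \<forall>x\<in>S. \<kappa> s u x = \<kappa> s t x \<bind> \<kappa> t u)"

definition natural_filtration ::
  "'w measure \<Rightarrow> real set \<Rightarrow> (real \<Rightarrow> 'w \<Rightarrow> real) \<Rightarrow> real \<Rightarrow> 'w measure" where
  "natural_filtration M S X t =
     sigma (space M) (\<Union>s\<in>{0..t}. {X s -` B \<inter> space M | B. B \<in> sets (restrict_space borel S)})"

text \<open>
  The Karlin--McGregor setting asks for the strong Markov property. It is required here only with
  respect to the natural filtration of the process itself, without augmentation or
  right-continuous enlargement. Stopping times with values in \<open>{0..t}\<close> suffice: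
  replace \<open>\<tau>\<close> by \<open>min \<tau> t\<close>.
\<close>

definition strong_markov_process ::
  "'w measure \<Rightarrow> real \<Rightarrow> real set \<Rightarrow> (real \<Rightarrow> real \<Rightarrow> real \<Rightarrow> real measure) \<Rightarrow>
   (real \<Rightarrow> 'w \<Rightarrow> real) \<Rightarrow> bool" where
  "strong_markov_process M T S \<kappa> X \<longleftrightarrow>
     (\<forall>t\<in>{0..T}. X t \<in> M \<rightarrow>\<^sub>M restrict_space borel S) \<and>
     (\<forall>t\<in>{0..T}. \<forall>\<tau>. \<forall>B\<in>sets (restrict_space borel S).
        stopping_time (natural_filtration M S X) \<tau> \<and> (\<forall>\<omega>\<in>space M. \<tau> \<omega> \<in> {0..t}) \<longrightarrow>
        (AE \<omega> in M.
           real_cond_exp M (filtration.pre_sigma (space M) (natural_filtration M S X) \<tau>)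
             (indicator (X t -` B \<inter> space M)) \<omega>
           = measure (\<kappa> (\<tau> \<omega>) t (X (\<tau> \<omega>) \<omega>)) B))"

definition neighbours :: "real set \<Rightarrow> real \<Rightarrow> real \<Rightarrow> bool" where
  "neighbours S a b \<longleftrightarrow> a \<in> S \<and> b \<in> S \<and> a \<noteq> b \<and> (\<forall>c\<in>S. \<not> (min a b < c \<and> c < max a b))"

definition neighbour_jump_path :: "real \<Rightarrow> real set \<Rightarrow> (real \<Rightarrow> real) \<Rightarrow> bool" where
  "neighbour_jump_path T S w \<longleftrightarrow>
     (\<forall>t\<in>{0..<T}. \<forall>\<^sub>F u in at_right t. w u = w t) \<and>
     (\<forall>t\<in>{0<..T}. \<exists>a. (\<forall>\<^sub>F u in at_left t. w u = a) \<and> (a = w t \<or> neighbours S a (w t)))"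

definition order_changes_only_by_meeting ::
  "real \<Rightarrow> (real \<Rightarrow> real) \<Rightarrow> (real \<Rightarrow> real) \<Rightarrow> bool" where
  "order_changes_only_by_meeting T v w \<longleftrightarrow>
     (\<forall>s\<in>{0..T}. \<forall>t\<in>{s..T}. v s < w s \<and> w t < v t \<longrightarrow> (\<exists>u\<in>{s..t}. v u = w u))"

text \<open>
  In the discrete case the last condition does not follow from nearest-neighbour jumps alone: two
  particles on adjacent sites could exchange places in a single instant if jumps happen at fixed
  times with positive probability (simple random walks started with different parity). It holds
  automatically for independent copies without fixed jump times, and for continuous paths.
\<close>

definition skip_free ::
  "'w measure \<Rightarrow> real \<Rightarrow> real set \<Rightarrow> nat \<Rightarrow> (nat \<Rightarrow> real \<Rightarrow> 'w \<Rightarrow> real) \<Rightarrow> bool" where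
  "skip_free M T S n X \<longleftrightarrow>
     (is_interval S \<and> (\<forall>i<n. \<forall>\<omega>\<in>space M. continuous_on {0..T} (\<lambda>t. X i t \<omega>))) \<or>
     (countable S \<and>
      (\<forall>i<n. \<forall>\<omega>\<in>space M. neighbour_jump_path T S (\<lambda>t. X i t \<omega>)) \<and>
      (\<forall>i<n. \<forall>j<n. AE \<omega> in M.
         order_changes_only_by_meeting T (\<lambda>t. X i t \<omega>) (\<lambda>t. X j t \<omega>)))"

lemma continuous_order_changes_only_by_meeting:
  assumes "continuous_on {0..T} v" "continuous_on {0..T} w"
  shows "order_changes_only_by_meeting T v w"
  unfolding order_changes_only_by_meeting_def
proof (intro ballI impI)
  fix s t assume s: "s \<in> {0..T}" and t: "t \<in> {s..T}" and st: "v s < w s \<and> w t < v t"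
  have "continuous_on {s..t} (\<lambda>u. v u - w u)"
    using s t by (intro continuous_on_diff continuous_on_subset[OF assms(1)]
        continuous_on_subset[OF assms(2)]) auto
  then obtain u where "s \<le> u" "u \<le> t" "v u - w u = 0"
    using IVT'[of "\<lambda>u. v u - w u" s 0 t] st t by auto
  then show "\<exists>u\<in>{s..t}. v u = w u" by auto
qed

text \<open>
  \<open>X i\<close> (\<open>i < n\<close>) are independent copies of the one-particle process, \<open>X i\<close> started at \<open>x i\<close>.
\<close>

definition independent_copies ::
  "'w measure \<Rightarrow> real \<Rightarrow> real set \<Rightarrow> (real \<Rightarrow> real \<Rightarrow> real \<Rightarrow> real measure) \<Rightarrow> nat \<Rightarrow>
   (nat \<Rightarrow> real) \<Rightarrow> (nat \<Rightarrow> real \<Rightarrow> 'w \<Rightarrow> real) \<Rightarrow> bool" where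
  "independent_copies M T S \<kappa> n x X \<longleftrightarrow>
     (\<forall>i<n. strong_markov_process M T S \<kappa> (X i) \<and> (AE \<omega> in M. X i 0 \<omega> = x i)) \<and>
     prob_space.indep_vars M (\<lambda>_. Pi\<^sub>M {0..T} (\<lambda>_. restrict_space borel S))
       (\<lambda>i \<omega>. \<lambda>t\<in>{0..T}. X i t \<omega>) {..<n}"

text \<open>
  \<open>coalesced w i\<close> is the path of the particle started from the \<open>i\<close>-th (ordered) site when the
  particles are driven by the paths \<open>w 0, w 1, \<dots>\<close>. It follows \<open>w i\<close> until it meets the particle
  below it and sticks to that particle from then on; as order is preserved, a particle meets any
  lower one through its predecessor. After a meeting the merged particle thus uses the driving
  path of the lowest one.
\<close>

fun coalesced :: "(nat \<Rightarrow> real \<Rightarrow> real) \<Rightarrow> nat \<Rightarrow> real \<Rightarrow> real" where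
  "coalesced w 0 t = w 0 t"
| "coalesced w (Suc i) t =
     (if \<exists>s\<in>{0..t}. w (Suc i) s = coalesced w i s then coalesced w i t else w (Suc i) t)"

definition one_particle_cdf ::
  "real \<Rightarrow> real set \<Rightarrow> (real \<Rightarrow> real \<Rightarrow> real \<Rightarrow> real measure) \<Rightarrow> real \<Rightarrow> real \<Rightarrow> real" where
  "one_particle_cdf T S \<kappa> x y = measure (\<kappa> 0 T x) {z \<in> S. z \<le> y}"

lemma transition_function_prob:
  assumes "transition_function T S \<kappa>" "0 \<le> s" "s \<le> t" "t \<le> T" "x \<in> S"
  shows "prob_space (\<kappa> s t x)" "sets (\<kappa> s t x) = sets (restrict_space borel S)"
proof -
  have "(\<lambda>(s, x). \<kappa> s t x)
        \<in> restrict_space borel {0..t} \<Otimes>\<^sub>M restrict_space borel S \<rightarrow>\<^sub>M prob_algebra (restrict_space borel S)"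
    using assms unfolding transition_function_def by auto
  from measurable_space[OF this, of "(s, x)"] assms
  have "\<kappa> s t x \<in> space (prob_algebra (restrict_space borel S))"
    by (auto simp: space_pair_measure space_restrict_space)
  then show "prob_space (\<kappa> s t x)" "sets (\<kappa> s t x) = sets (restrict_space borel S)"
    by (auto simp: space_prob_algebra)
qed

lemma one_particle_cdf_discrete:
  assumes "transition_function T S \<kappa>" "countable S" "0 \<le> T" "x \<in> S"
  shows "((\<lambda>z. measure (\<kappa> 0 T x) {z}) has_sum one_particle_cdf T S \<kappa> x y) {z \<in> S. z \<le> y}"
proof -
  interpret prob_space "\<kappa> 0 T x"
    using transition_function_prob[OF assms(1)] assms by auto
  have S: "sets (\<kappa> 0 T x) = sets (restrict_space borel S)"
    using transition_function_prob[OF assms(1)] assms by auto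
  have single: "{z} \<in> sets (\<kappa> 0 T x)" if "z \<in> S" for z
    unfolding S sets_restrict_space using that by (intro image_eqI[of _ _ "{z}"]) auto
  let ?A = "{z \<in> S. z \<le> y}"
  have cA: "countable ?A"
    using assms(2) by (rule countable_subset[rotated]) auto
  have "emeasure (\<kappa> 0 T x) (\<Union>z\<in>?A. {z})
      = (\<integral>\<^sup>+z. emeasure (\<kappa> 0 T x) {z} \<partial>count_space ?A)"
    using cA single by (intro emeasure_UN_countable) (auto simp: disjoint_family_on_def)
  then have nn: "(\<integral>\<^sup>+z. ennreal (prob {z}) \<partial>count_space ?A) = ennreal (prob ?A)"
    by (simp add: emeasure_eq_measure)
  have "integrable (count_space ?A) (\<lambda>z. prob {z})"
    using nn by (intro integrableI_nonneg) auto
  then have sm: "Infinite_Set_Sum.abs_summable_on (\<lambda>z. prob {z}) ?A"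
    by (simp add: Infinite_Set_Sum.abs_summable_on_def)
  have "integral\<^sup>L (count_space ?A) (\<lambda>z. prob {z}) = prob ?A"
    using nn by (simp add: integral_eq_nn_integral)
  then have "infsetsum (\<lambda>z. prob {z}) ?A = prob ?A"
    by (simp add: infsetsum_def)
  moreover have "infsetsum (\<lambda>z. prob {z}) ?A = infsum (\<lambda>z. prob {z}) ?A"
    using sm by (rule infsetsum_infsum)
  moreover have "(\<lambda>z. prob {z}) summable_on ?A"
    using sm[folded abs_summable_equivalent] by simp
  ultimately show ?thesis
    unfolding one_particle_cdf_def using has_sum_infsum[of "\<lambda>z. prob {z}" ?A] by simp
qed

lemma one_particle_cdf_density:
  assumes "\<kappa> 0 T x = density (restrict_space lborel S) (\<lambda>z. ennreal (p z))"
    and "p \<in> borel_measurable borel" "\<And>z. 0 \<le> p z" "S \<in> sets borel"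
  shows "one_particle_cdf T S \<kappa> x y = (LINT z:{z \<in> S. z \<le> y}|lborel. p z)"
proof -
  let ?A = "{z \<in> S. z \<le> y}"
  have eq: "?A = S \<inter> {..y}" by auto
  have A: "?A \<in> sets borel" unfolding eq using assms(4) by auto
  have "emeasure (\<kappa> 0 T x) ?A
      = (\<integral>\<^sup>+z. ennreal (p z) * indicator ?A z \<partial>restrict_space lborel S)"
    unfolding assms(1) using A assms(2,4)
    by (intro emeasure_density)
      (auto simp: sets_restrict_space_iff intro!: measurable_restrict_space1)
  also have "\<dots> = (\<integral>\<^sup>+z. ennreal (p z) * indicator ?A z * indicator S z \<partial>lborel)"
    using assms(4) by (subst nn_integral_restrict_space) auto
  also have "\<dots> = (\<integral>\<^sup>+z. ennreal (indicator ?A z *\<^sub>R p z) \<partial>lborel)"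
    by (intro nn_integral_cong) (auto simp: indicator_def)
  finally have "measure (\<kappa> 0 T x) ?A
      = enn2real (\<integral>\<^sup>+z. ennreal (indicator ?A z *\<^sub>R p z) \<partial>lborel)"
    by (simp add: measure_def)
  also have "\<dots> = (LINT z:?A|lborel. p z)"
    unfolding set_lebesgue_integral_def using A assms(2,3)
    by (intro integral_eq_nn_integral[symmetric]) auto
  finally show ?thesis by (simp add: one_particle_cdf_def)
qed

end

theory Submission
  imports Defs
begin

text \<open>
  Write \<open>a\<^sub>j(z) = [z \<le> y\<^sub>j]\<close>, \<open>b\<^sub>i\<^sub>j = [i < j]\<close>, and let \<open>G s p j\<close> be the probability that a particle at \<open>p\<close>
  at time \<open>s\<close> is at or below \<open>y\<^sub>j\<close> at time \<open>T\<close>. The theorem is about the determinant with rows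
  \<open>G 0 x\<^sub>i - b\<^sub>i\<close>, the expectations of the rows \<open>a(X\<^sub>i(T)) - b\<^sub>i\<close>.

  For weakly increasing numbers \<open>z\<^sub>i\<close> the determinant with rows \<open>a(z\<^sub>i) - b\<^sub>i\<close> is the indicator of
  \<open>z\<^sub>i \<le> y\<^sub>i\<close> for all \<open>i\<close> (\<open>rows_det_indicator\<close>). Coalescing particles stay ordered
  (\<open>coalesced_ordered\<close>), so the probability in question is the expectation of the determinant with
  rows \<open>a(Z\<^sub>i(T)) - b\<^sub>i\<close>. It remains to replace, from the last row to the first, \<open>a(Z\<^sub>k(T))\<close> by \<open>G 0 x\<^sub>k\<close>
  without changing the expectation. With \<open>\<and>\<close> for the wedge product of rows, this is the
  case \<open>\<sigma> = 0\<close> of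
  \<open>E[(a(Z\<^sub>0(T)) - b\<^sub>0) \<and> \<dots> \<and> (a(Z\<^sub>k\<^sub>-\<^sub>1(T)) - b\<^sub>k\<^sub>-\<^sub>1) \<and> (a(Z\<^sub>k(T)) - G \<sigma> (Z\<^sub>k(\<sigma>))) \<and> Q] = 0\<close>,
  for every stopping time \<open>\<sigma>\<close> with values in \<open>{0..T}\<close> and all bounded rows \<open>Q\<close> known at time \<open>\<sigma>\<close>
  (\<open>coalesced_fluctuation\<close>). The proof is by induction on \<open>k\<close>. Let \<open>\<rho>\<close> be the time at which the
  driving path of particle \<open>k\<close> meets \<open>Z\<^sub>k\<^sub>-\<^sub>1\<close>. The driving path is strongly Markov and independent of the
  lower particles, so its own fluctuations after \<open>\<sigma>\<close> and after \<open>\<rho>\<close> contribute nothing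
  (\<open>free_row_expectation_zero\<close>). What is left is a fluctuation of \<open>Z\<^sub>k\<^sub>-\<^sub>1\<close> after the later one of \<open>\<sigma>\<close>
  and \<open>\<rho>\<close>. There rows \<open>k - 1\<close> and \<open>k\<close> are \<open>a - b\<close> and \<open>a - g\<close>, with \<open>a\<close> the same in both and \<open>g\<close>
  known at that time, and \<open>(a - b) \<and> (a - g) = (a - g) \<and> (b - g)\<close> (\<open>rows_det_wedge\<close>). On the right the
  fluctuation has moved to row \<open>k - 1\<close> and row \<open>k\<close> is known, so the induction hypothesis applies.

  The strong Markov property is given for each particle with respect to its own past, while \<open>\<sigma>\<close> and
  \<open>\<rho>\<close> look at all particles. The particles are therefore moved to a product space, with the product
  of their natural filtrations. If all coordinates but one are frozen there, a stopping time becomes a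
  stopping time of the remaining particle (\<open>stopping_time_section\<close>), and Fubini's theorem gives
  \<open>strong_markov_frozen\<close>. To go from the given space to the product, coalesced positions must be
  measurable functions of the paths, although a meeting is an event about uncountably many times; for the
  paths at hand it can be detected at rational times (\<open>nearly_meet_iff\<close>).
\<close>

section \<open>Determinants as functions of their rows\<close>

text \<open>
  Rows are functions so that they can be updated one at a time.
\<close>
definition rows_det :: "nat \<Rightarrow> (nat \<Rightarrow> nat \<Rightarrow> real) \<Rightarrow> real" where
  "rows_det n r = Determinant.det (Matrix.mat n n (\<lambda>(i, j). r i j))"

lemma rows_det_perm:
  "rows_det n r = (\<Sum>p | p permutes {0..<n}. signof p * (\<Prod>i = 0..<n. r i (p i)))"
  unfolding rows_det_def
  by (subst det_def'[of _ n])
     (auto intro!: sum.cong prod.cong simp: permutes_in_image)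

lemma rows_det_cong:
  "(\<And>i j. i < n \<Longrightarrow> j < n \<Longrightarrow> r i j = r' i j) \<Longrightarrow> rows_det n r = rows_det n r'"
  unfolding rows_det_def by (intro arg_cong[where f = Determinant.det]) auto

lemma rows_det_linear:
  assumes "k < n"
    and "\<And>i j. i < n \<Longrightarrow> j < n \<Longrightarrow> i \<noteq> k \<Longrightarrow> r1 i j = r i j \<and> r2 i j = r i j"
    and "\<And>j. j < n \<Longrightarrow> r k j = c * r1 k j + r2 k j"
  shows "rows_det n r = c * rows_det n r1 + rows_det n r2"
proof -
  have "(\<Prod>i = 0..<n. r i (p i)) = c * (\<Prod>i = 0..<n. r1 i (p i)) + (\<Prod>i = 0..<n. r2 i (p i))"
    if p: "p permutes {0..<n}" for p
  proof -
    have pn: "p i < n" if "i < n" for i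
      using permutes_in_image[OF p, of i] that by simp
    have split: "(\<Prod>i = 0..<n. f i (p i)) = f k (p k) * (\<Prod>i\<in>{0..<n} - {k}. f i (p i))"
      for f :: "nat \<Rightarrow> nat \<Rightarrow> real"
      using assms(1) by (subst prod.remove[of _ k]) auto
    have "(\<Prod>i\<in>{0..<n} - {k}. r1 i (p i)) = (\<Prod>i\<in>{0..<n} - {k}. r i (p i))"
      "(\<Prod>i\<in>{0..<n} - {k}. r2 i (p i)) = (\<Prod>i\<in>{0..<n} - {k}. r i (p i))"
      using assms(2) pn by (auto intro!: prod.cong)
    then show ?thesis
      unfolding split using assms(3)[OF pn[OF assms(1)]] by (simp add: algebra_simps)
  qed
  then show ?thesis
    unfolding rows_det_perm
    by (simp add: sum_distrib_left sum.distrib[symmetric] algebra_simps)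
qed

lemma rows_det_equal_rows:
  assumes "i \<noteq> k" "i < n" "k < n" "\<And>j. j < n \<Longrightarrow> r i j = r k j"
  shows "rows_det n r = 0"
  unfolding rows_det_def
  by (rule det_identical_rows[of _ n i k]) (use assms in \<open>auto simp: row_def\<close>)

lemma rows_det_expand:
  assumes k: "k < n"
  shows "rows_det n (r(k := c)) = (\<Sum>l<n. c l * rows_det n (r(k := (\<lambda>j. of_bool (j = l)))))"
proof -
  have "rows_det n (r(k := (\<lambda>j. if j < m then c j else 0)))
      = (\<Sum>l<m. c l * rows_det n (r(k := (\<lambda>j. of_bool (j = l)))))" if "m \<le> n" for m
    using that
  proof (induction m)
    case 0
    have "rows_det n (r(k := (\<lambda>_. 0))) = 1 * rows_det n (r(k := (\<lambda>_. 0))) + rows_det n (r(k := (\<lambda>_. 0)))"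
      by (rule rows_det_linear[OF k]) auto
    then show ?case by (simp add: fun_upd_def)
  next
    case (Suc m)
    have "rows_det n (r(k := (\<lambda>j. if j < Suc m then c j else 0)))
        = c m * rows_det n (r(k := (\<lambda>j. of_bool (j = m)))) + rows_det n (r(k := (\<lambda>j. if j < m then c j else 0)))"
      by (rule rows_det_linear[OF k]) (auto simp: less_Suc_eq)
    with Suc show ?case by (simp add: fun_upd_def)
  qed
  from this[of n] have "rows_det n (r(k := (\<lambda>j. if j < n then c j else 0)))
      = (\<Sum>l<n. c l * rows_det n (r(k := (\<lambda>j. of_bool (j = l)))))" by simp
  moreover have "rows_det n (r(k := c)) = rows_det n (r(k := (\<lambda>j. if j < n then c j else 0)))"
    by (rule rows_det_cong) auto
  ultimately show ?thesis by simp
qed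

text \<open>
  In terms of wedge products of rows: \<open>(u - v) \<and> u = u \<and> v\<close>. With \<open>u = a - g\<close> and \<open>v = b - g\<close> this
  turns the rows \<open>a - b\<close>, \<open>a - g\<close> of two merged particles into \<open>a - g\<close>, \<open>b - g\<close>, only the first of which
  contains the common future position.
\<close>
lemma rows_det_wedge:
  assumes ik: "i \<noteq> k" "i < n" "k < n"
    and off: "\<And>l j. l < n \<Longrightarrow> j < n \<Longrightarrow> l \<noteq> i \<Longrightarrow> l \<noteq> k \<Longrightarrow> r' l j = r l j"
    and r: "\<And>j. j < n \<Longrightarrow> r i j = r' i j - r' k j" "\<And>j. j < n \<Longrightarrow> r k j = r' i j"
  shows "rows_det n r = rows_det n r'"
proof -
  have "rows_det n r = - 1 * rows_det n (r(i := r' k)) + rows_det n (r(i := r' i))"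
    by (rule rows_det_linear[OF ik(2)]) (auto simp: r)
  also have "rows_det n (r(i := r' i)) = 0"
    by (rule rows_det_equal_rows[OF ik]) (use ik in \<open>auto simp: r\<close>)
  finally have A: "rows_det n r = - rows_det n (r(i := r' k))" by (simp add: fun_upd_def)
  \<comment> \<open>Exchanging two rows changes the sign: expand the determinant with the sum of the rows in both places.\<close>
  have "rows_det n (r'(i := \<lambda>j. r' i j + r' k j, k := \<lambda>j. r' i j + r' k j)) = 0"
    by (rule rows_det_equal_rows[OF ik]) (use ik in auto)
  also have "rows_det n (r'(i := \<lambda>j. r' i j + r' k j, k := \<lambda>j. r' i j + r' k j))
      = 1 * rows_det n (r'(k := \<lambda>j. r' i j + r' k j))
        + rows_det n (r'(i := r' k, k := \<lambda>j. r' i j + r' k j))"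
    by (rule rows_det_linear[OF ik(2)]) (use ik in auto)
  also have "rows_det n (r'(k := \<lambda>j. r' i j + r' k j))
      = 1 * rows_det n (r'(k := r' i)) + rows_det n r'"
    by (rule rows_det_linear[OF ik(3)]) (use ik in auto)
  also have "rows_det n (r'(k := r' i)) = 0"
    by (rule rows_det_equal_rows[OF ik]) (use ik in auto)
  also have "rows_det n (r'(i := r' k, k := \<lambda>j. r' i j + r' k j))
      = 1 * rows_det n (r'(i := r' k, k := r' i)) + rows_det n (r'(i := r' k))"
    by (rule rows_det_linear[OF ik(3)]) (use ik in auto)
  also have "rows_det n (r'(i := r' k)) = 0"
    by (rule rows_det_equal_rows[OF ik]) (use ik in auto)
  also have "rows_det n (r'(i := r' k, k := r' i)) = rows_det n (r(i := r' k))"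
    by (rule rows_det_cong) (use ik off r in auto)
  finally show ?thesis using A by simp
qed

text \<open>
  If all \<open>z i \<le> y i\<close>, the matrix is lower triangular with ones on the diagonal. If \<open>y i < z i\<close>, then the
  rows from \<open>i\<close> on vanish in the columns up to \<open>i\<close>: \<open>n - i\<close> rows are supported in only \<open>n - i - 1\<close>
  columns.
\<close>
lemma rows_det_indicator:
  fixes z y :: "nat \<Rightarrow> real"
  assumes z: "\<And>i j. i \<le> j \<Longrightarrow> j < n \<Longrightarrow> z i \<le> z j" and y: "\<And>i j. i \<le> j \<Longrightarrow> j < n \<Longrightarrow> y i \<le> y j"
  shows "rows_det n (\<lambda>i j. of_bool (z i \<le> y j) - of_bool (i < j)) = of_bool (\<forall>i<n. z i \<le> y i)"
    (is "rows_det n ?r = _")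
proof (cases "\<forall>i<n. z i \<le> y i")
  case True
  have up: "?r i j = 0" if "i < j" "j < n" for i j
    using True that y[of i j] by (auto intro: order_trans[of _ "y i"])
  have "rows_det n ?r = prod_list (diag_mat (Matrix.mat n n (\<lambda>(i, j). ?r i j)))"
    unfolding rows_det_def by (rule det_lower_triangular[of n]) (use up in auto)
  also have "diag_mat (Matrix.mat n n (\<lambda>(i, j). ?r i j)) = map (\<lambda>_. 1) [0..<n]"
    unfolding diag_mat_def using True by (auto intro!: map_cong)
  finally show ?thesis using True by (simp add: map_replicate_const prod_list_replicate)
next
  case False
  then obtain i where i: "i < n" "y i < z i" by (auto simp: not_le)
  have zero: "?r l j = 0" if "i \<le> l" "l < n" "j \<le> i" for l j
    using i z[OF that(1,2)] y[of j i] that by auto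
  have "(\<Prod>l = 0..<n. ?r l (p l)) = 0" if p: "p permutes {0..<n}" for p
  proof -
    have "\<exists>l\<in>{i..<n}. p l \<le> i"
    proof (rule ccontr)
      assume "\<not> ?thesis"
      moreover have "p l < n" if "l < n" for l using permutes_in_image[OF p, of l] that by simp
      ultimately have "p ` {i..<n} \<subseteq> {Suc i..<n}"
        by (auto simp: not_le Suc_le_eq)
      then have "card (p ` {i..<n}) \<le> card {Suc i..<n}" by (intro card_mono) auto
      moreover have "card (p ` {i..<n}) = card {i..<n}"
        using permutes_inj[OF p] by (intro card_image) (auto simp: inj_on_def)
      ultimately show False using i by simp
    qed
    then obtain l where "i \<le> l" "l < n" "p l \<le> i" by auto
    then show ?thesis using zero[of l "p l"] by (intro prod_zero bexI[of _ l]) simp_all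
  qed
  then have "rows_det n ?r = 0"
    unfolding rows_det_perm by (intro sum.neutral ballI) (simp only: mem_Collect_eq mult_zero_right)
  with False show ?thesis by simp
qed

section \<open>Meeting and coalescing paths\<close>

text \<open>
  The value \<open>T + 1\<close> stands for paths that do not meet up to time \<open>T\<close>.
\<close>
definition first_meeting :: "real \<Rightarrow> (real \<Rightarrow> real) \<Rightarrow> (real \<Rightarrow> real) \<Rightarrow> real" where
  "first_meeting T v w =
     (if \<exists>s\<in>{0..T}. v s = w s then Inf {s \<in> {0..T}. v s = w s} else T + 1)"

text \<open>
  A substitute for the existence of a meeting up to time \<open>t\<close> that involves the paths at countably many
  times only, and is therefore a measurable condition. The time \<open>t\<close> is added because a meeting at \<open>t\<close>
  itself need not be visible at earlier rational times.
\<close>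
definition nearly_meet :: "real \<Rightarrow> (real \<Rightarrow> real) \<Rightarrow> (real \<Rightarrow> real) \<Rightarrow> bool" where
  "nearly_meet t v w \<longleftrightarrow>
     (\<forall>m::nat. \<exists>r\<in>{0..t} \<inter> \<rat> \<union> {t}. \<bar>v r - w r\<bar> < 1 / (real m + 1))"

lemma nearly_meet_cong:
  assumes "0 \<le> t" "\<And>s. 0 \<le> s \<Longrightarrow> s \<le> t \<Longrightarrow> v s = v' s \<and> w s = w' s"
  shows "nearly_meet t v w \<longleftrightarrow> nearly_meet t v' w'"
proof -
  have "v r = v' r \<and> w r = w' r" if "r \<in> {0..t} \<inter> \<rat> \<union> {t}" for r
    using assms that by auto
  then have "(\<exists>r\<in>{0..t} \<inter> \<rat> \<union> {t}. \<bar>v r - w r\<bar> < e) \<longleftrightarrow> (\<exists>r\<in>{0..t} \<inter> \<rat> \<union> {t}. \<bar>v' r - w' r\<bar> < e)" for e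
    by (intro bex_cong refl) (simp only:)
  then show ?thesis unfolding nearly_meet_def by (simp only:)
qed

text \<open>
  Agrees with \<^const>\<open>coalesced\<close> on well-behaved paths (\<open>approx_coalesced_eq\<close> below), but is a measurable
  function of arbitrary paths with respect to the product \<open>\<sigma>\<close>-algebra.
\<close>
fun approx_coalesced :: "(nat \<Rightarrow> real \<Rightarrow> real) \<Rightarrow> nat \<Rightarrow> real \<Rightarrow> real" where
  "approx_coalesced w 0 t = w 0 t"
| "approx_coalesced w (Suc i) t =
     (if nearly_meet t (w (Suc i)) (approx_coalesced w i) then approx_coalesced w i t else w (Suc i) t)"

text \<open>
  As simplification rules these would unfold every coalesced path into nested meeting conditions.
\<close>
declare coalesced.simps(2) [simp del] approx_coalesced.simps(2) [simp del]

lemma coalesced_zero: "coalesced w i 0 = w i 0"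
  by (induction i) (auto simp: coalesced.simps(2))

lemma coalesced_cong: "(\<And>j. j \<le> i \<Longrightarrow> v j = w j) \<Longrightarrow> coalesced v i t = coalesced w i t"
proof (induction i arbitrary: t)
  case (Suc i)
  have IH: "coalesced v i s = coalesced w i s" for s using Suc by auto
  show ?case using Suc.prems[of "Suc i"] by (simp only: coalesced.simps(2) IH order_refl)
qed simp

lemma coalesced_eq_driving: "\<exists>j\<le>i. coalesced w i t = w j t"
  by (induction i) (auto simp: coalesced.simps(2) intro: le_SucI)

lemma approx_coalesced_cong:
  "(\<And>j s. j \<le> i \<Longrightarrow> 0 \<le> s \<Longrightarrow> s \<le> t \<Longrightarrow> v j s = w j s) \<Longrightarrow> 0 \<le> t \<Longrightarrow> approx_coalesced v i t = approx_coalesced w i t"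
proof (induction i arbitrary: t)
  case (Suc i)
  have eq: "approx_coalesced v i s = approx_coalesced w i s" if "0 \<le> s" "s \<le> t" for s
    using Suc.IH[of s] Suc.prems(1) that by auto
  have "nearly_meet t (v (Suc i)) (approx_coalesced v i) \<longleftrightarrow> nearly_meet t (w (Suc i)) (approx_coalesced w i)"
    by (rule nearly_meet_cong) (use Suc.prems(2) eq in \<open>auto intro!: Suc.prems(1)\<close>)
  with eq[of t] Suc.prems(1)[of "Suc i" t] Suc.prems(2) show ?case
    by (simp add: approx_coalesced.simps(2))
next
  case 0
  then show ?case by (simp only: approx_coalesced.simps(1) order_refl)
qed

text \<open>
  What the argument needs from the paths, so that the continuous and the discrete case can be treated
  together: right continuity makes first meetings attained, \<open>meet\<close> lets meetings be detected at rational
  times, and \<open>switch\<close> keeps coalesced paths in the class.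
\<close>
locale path_class =
  fixes T :: real and R :: "(real \<Rightarrow> real) set"
  assumes T_pos: "0 < T"
    and right_cont: "w \<in> R \<Longrightarrow> 0 \<le> t \<Longrightarrow> t < T \<Longrightarrow> (w \<longlongrightarrow> w t) (at_right t)"
    and meet: "v \<in> R \<Longrightarrow> w \<in> R \<Longrightarrow> 0 \<le> t \<Longrightarrow> t \<le> T \<Longrightarrow> nearly_meet t v w \<Longrightarrow> \<exists>s\<in>{0..t}. v s = w s"
    and switch: "v \<in> R \<Longrightarrow> w \<in> R \<Longrightarrow> 0 \<le> s \<Longrightarrow> s \<le> T \<Longrightarrow> v s = w s \<Longrightarrow>
          (\<lambda>t. if t < s then v t else w t) \<in> R"
    and path_cong: "w \<in> R \<Longrightarrow> (\<And>t. 0 \<le> t \<Longrightarrow> t \<le> T \<Longrightarrow> v t = w t) \<Longrightarrow> v \<in> R"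
begin

text \<open>
  A sequence of meeting times that decreases to the infimum has its limit among the meeting times by
  right continuity of both paths.
\<close>
lemma first_meeting_attained:
  assumes v: "v \<in> R" and w: "w \<in> R" and ex: "\<exists>s\<in>{0..T}. v s = w s"
  shows "first_meeting T v w \<in> {0..T}" "v (first_meeting T v w) = w (first_meeting T v w)"
proof -
  define A where "A = {s \<in> {0..T}. v s = w s}"
  define \<rho> where "\<rho> = Inf A"
  have fm: "first_meeting T v w = \<rho>"
    using ex by (simp add: first_meeting_def A_def \<rho>_def)
  have ne: "A \<noteq> {}" using ex by (auto simp: A_def)
  have bb: "bdd_below A" by (rule bdd_belowI[of _ 0]) (auto simp: A_def)
  obtain s0 where s0: "s0 \<in> A" using ne by auto
  have \<rho>0: "0 \<le> \<rho>" unfolding \<rho>_def by (rule cInf_greatest[OF ne]) (auto simp: A_def)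
  have \<rho>s: "\<rho> \<le> s" if "s \<in> A" for s unfolding \<rho>_def by (rule cInf_lower[OF that bb])
  have \<rho>T: "\<rho> \<le> T" using \<rho>s[OF s0] s0 by (auto simp: A_def)
  have "\<rho> \<in> A"
  proof (rule ccontr)
    assume nA: "\<rho> \<notin> A"
    have lt: "\<rho> < T" using \<rho>s[OF s0] s0 nA by (cases "\<rho> = s0") (auto simp: A_def)
    have "((\<lambda>s. v s - w s) \<longlongrightarrow> v \<rho> - w \<rho>) (at_right \<rho>)"
      using right_cont[OF v \<rho>0 lt] right_cont[OF w \<rho>0 lt] by (rule tendsto_diff)
    moreover have "v \<rho> - w \<rho> \<noteq> 0" using nA \<rho>0 \<rho>T by (auto simp: A_def)
    ultimately have "\<forall>\<^sub>F s in at_right \<rho>. v s - w s \<noteq> 0" by (rule tendsto_imp_eventually_ne)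
    then obtain b where b: "b > \<rho>" "\<And>s. \<rho> < s \<Longrightarrow> s < b \<Longrightarrow> v s - w s \<noteq> 0"
      unfolding eventually_at_right_field by auto
    obtain s where s: "s \<in> A" "s < b"
      using cInf_lessD[OF ne, of b] b(1) by (auto simp: \<rho>_def)
    have "\<rho> < s" using \<rho>s[OF s(1)] nA s(1) by (cases "\<rho> = s") auto
    then show False using b(2)[of s] s by (auto simp: A_def)
  qed
  then show "first_meeting T v w \<in> {0..T}" "v (first_meeting T v w) = w (first_meeting T v w)"
    unfolding fm by (auto simp: A_def)
qed

lemma first_meeting_nonneg: "v \<in> R \<Longrightarrow> w \<in> R \<Longrightarrow> 0 \<le> first_meeting T v w"
  using first_meeting_attained(1)[of v w] T_pos by (cases "\<exists>s\<in>{0..T}. v s = w s") (auto simp: first_meeting_def)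

lemma first_meeting_le_iff:
  assumes v: "v \<in> R" and w: "w \<in> R" and t: "t \<le> T"
  shows "first_meeting T v w \<le> t \<longleftrightarrow> (\<exists>s\<in>{0..t}. v s = w s)"
proof
  assume le: "first_meeting T v w \<le> t"
  then have "\<exists>s\<in>{0..T}. v s = w s"
    using t by (auto simp: first_meeting_def split: if_splits)
  from first_meeting_attained[OF v w this] le show "\<exists>s\<in>{0..t}. v s = w s" by auto
next
  assume "\<exists>s\<in>{0..t}. v s = w s"
  then obtain s where s: "0 \<le> s" "s \<le> t" "v s = w s" by auto
  have "first_meeting T v w \<le> s"
  proof -
    have "Inf {s \<in> {0..T}. v s = w s} \<le> s"
      by (rule cInf_lower) (use s t in \<open>auto intro!: bdd_belowI[of _ 0]\<close>)
    moreover have "\<exists>s\<in>{0..T}. v s = w s" using s t by (intro bexI[of _ s]) auto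
    ultimately show ?thesis by (simp add: first_meeting_def)
  qed
  with s show "first_meeting T v w \<le> t" by simp
qed

lemma first_meeting_meets:
  assumes "v \<in> R" "w \<in> R" "first_meeting T v w \<le> T"
  shows "v (first_meeting T v w) = w (first_meeting T v w)"
  using assms first_meeting_le_iff[of v w T] by (intro first_meeting_attained) auto

lemma coalesced_Suc_first_meeting:
  assumes "w (Suc i) \<in> R" "coalesced w i \<in> R" "t \<le> T"
  shows "coalesced w (Suc i) t =
    (if first_meeting T (w (Suc i)) (coalesced w i) \<le> t then coalesced w i t else w (Suc i) t)"
  using first_meeting_le_iff[OF assms] by (simp add: coalesced.simps(2))

lemma coalesced_in_class: "(\<And>j. j \<le> i \<Longrightarrow> w j \<in> R) \<Longrightarrow> coalesced w i \<in> R"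
proof (induction i)
  case 0
  then show ?case by (auto intro: ext simp: ext[of "coalesced w 0" "w 0"])
next
  case (Suc i)
  have Z: "coalesced w i \<in> R" using Suc by auto
  have X: "w (Suc i) \<in> R" using Suc by auto
  let ?\<rho> = "first_meeting T (w (Suc i)) (coalesced w i)"
  show ?case
  proof (cases "?\<rho> \<le> T")
    case True
    show ?thesis
      by (rule path_cong[OF switch[OF X Z _ True first_meeting_meets[OF X Z True]]])
         (use coalesced_Suc_first_meeting[of w i, OF X Z] first_meeting_nonneg[OF X Z] in auto)
  next
    case False
    show ?thesis
      by (rule path_cong[OF X])
         (use coalesced_Suc_first_meeting[of w i, OF X Z] False in auto)
  qed
qed

text \<open>
  Just after a meeting right-continuous paths are still close, and there are rational times just after
  it. The converse is part of what is required of the class.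
\<close>
lemma nearly_meet_iff:
  assumes v: "v \<in> R" and w: "w \<in> R" and t: "0 \<le> t" "t \<le> T"
  shows "nearly_meet t v w \<longleftrightarrow> (\<exists>s\<in>{0..t}. v s = w s)"
proof
  assume "\<exists>s\<in>{0..t}. v s = w s"
  then obtain s where s: "0 \<le> s" "s \<le> t" "v s = w s" by auto
  show "nearly_meet t v w"
  proof (cases "s = t")
    case True
    then show ?thesis using s by (auto simp: nearly_meet_def intro!: bexI[of _ t])
  next
    case False
    then have st: "s < t" using s by simp
    have lim: "((\<lambda>s. \<bar>v s - w s\<bar>) \<longlongrightarrow> 0) (at_right s)"
      using tendsto_rabs[OF tendsto_diff[OF right_cont[OF v, of s] right_cont[OF w, of s]]] s st t by simp
    show ?thesis unfolding nearly_meet_def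
    proof
      fix m :: nat
      have "\<forall>\<^sub>F u in at_right s. \<bar>v u - w u\<bar> < 1 / (real m + 1)"
        by (rule order_tendstoD(2)[OF lim]) simp
      then obtain b where b: "b > s" "\<And>u. s < u \<Longrightarrow> u < b \<Longrightarrow> \<bar>v u - w u\<bar> < 1 / (real m + 1)"
        unfolding eventually_at_right_field by auto
      obtain r where "r \<in> \<rat>" "s < r" "r < min b t"
        using Rats_dense_in_real[of s "min b t"] b(1) st by auto
      then show "\<exists>r\<in>{0..t} \<inter> \<rat> \<union> {t}. \<bar>v r - w r\<bar> < 1 / (real m + 1)"
        using b(2)[of r] s by (intro bexI[of _ r]) auto
    qed
  qed
qed (use meet[OF v w t] in blast)

lemma approx_coalesced_eq:
  "(\<And>j. j \<le> i \<Longrightarrow> w j \<in> R) \<Longrightarrow> 0 \<le> t \<Longrightarrow> t \<le> T \<Longrightarrow> approx_coalesced w i t = coalesced w i t"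
proof (induction i arbitrary: t)
  case (Suc i)
  have eq: "approx_coalesced w i s = coalesced w i s" if "0 \<le> s" "s \<le> T" for s
    using Suc.IH[of s] Suc.prems(1) that by auto
  have "nearly_meet t (w (Suc i)) (approx_coalesced w i) \<longleftrightarrow> nearly_meet t (w (Suc i)) (coalesced w i)"
    by (rule nearly_meet_cong) (use Suc.prems eq in auto)
  also have "\<dots> \<longleftrightarrow> (\<exists>s\<in>{0..t}. w (Suc i) s = coalesced w i s)"
    using Suc.prems coalesced_in_class[of i w] by (intro nearly_meet_iff) auto
  finally have *: "nearly_meet t (w (Suc i)) (approx_coalesced w i)
      \<longleftrightarrow> (\<exists>s\<in>{0..t}. w (Suc i) s = coalesced w i s)" .
  show ?case
    by (simp only: approx_coalesced.simps(2) coalesced.simps(2) * eq[OF Suc.prems(2,3)])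
next
  case 0
  show ?case by (simp only: approx_coalesced.simps(1) coalesced.simps(1))
qed

text \<open>
  A coalesced path is a driving path before the meeting time \<open>\<rho>\<close> and the next lower coalesced path
  afterwards. If \<open>v\<close> changes sides between \<open>s < \<rho>\<close> and \<open>t \<ge> \<rho>\<close>, it is on one of the two sides at
  time \<open>\<rho>\<close>, where both pieces agree, and so it changes sides with respect to one of the pieces.
\<close>
lemma coalesced_order_changes_only_by_meeting:
  assumes "\<And>j. j \<le> i \<Longrightarrow> w j \<in> R" "\<And>j. j \<le> i \<Longrightarrow> order_changes_only_by_meeting T (w j) v"
  shows "order_changes_only_by_meeting T (coalesced w i) v"
  using assms
proof (induction i)
  case 0
  then show ?case by (simp add: order_changes_only_by_meeting_def)
next
  case (Suc i)
  have IH: "order_changes_only_by_meeting T (coalesced w i) v" using Suc by auto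
  have XO: "order_changes_only_by_meeting T (w (Suc i)) v" using Suc by auto
  have Z: "coalesced w i \<in> R" using Suc.prems by (intro coalesced_in_class) auto
  have X: "w (Suc i) \<in> R" using Suc by auto
  let ?\<rho> = "first_meeting T (w (Suc i)) (coalesced w i)"
  let ?Z = "coalesced w i" and ?X = "w (Suc i)" and ?Y = "coalesced w (Suc i)"
  have before: "?Y u = ?X u" if "u < ?\<rho>" "u \<le> T" for u
    using coalesced_Suc_first_meeting[of w i, OF X Z that(2)] that by simp
  have after: "?Y u = ?Z u" if "?\<rho> \<le> u" "u \<le> T" for u
    using coalesced_Suc_first_meeting[of w i, OF X Z that(2)] that by simp
  show ?case unfolding order_changes_only_by_meeting_def
  proof (intro ballI impI)
    fix s t assume s: "s \<in> {0..T}" and t: "t \<in> {s..T}" and st: "?Y s < v s \<and> v t < ?Y t"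
    have XO': "\<exists>u\<in>{s'..t'}. ?X u = v u" if "0 \<le> s'" "s' \<le> t'" "t' \<le> T" "?X s' < v s'" "v t' < ?X t'" for s' t'
      using XO that unfolding order_changes_only_by_meeting_def by (meson atLeastAtMost_iff order_trans)
    have ZO': "\<exists>u\<in>{s'..t'}. ?Z u = v u" if "0 \<le> s'" "s' \<le> t'" "t' \<le> T" "?Z s' < v s'" "v t' < ?Z t'" for s' t'
      using IH that unfolding order_changes_only_by_meeting_def by (meson atLeastAtMost_iff order_trans)
    consider "t < ?\<rho>" | "?\<rho> \<le> s" | "s < ?\<rho>" "?\<rho> \<le> t" by linarith
    then show "\<exists>u\<in>{s..t}. ?Y u = v u"
    proof cases
      case 1
      then obtain u where "u\<in>{s..t}" "?X u = v u" using XO'[of s t] before s t st by auto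
      then show ?thesis using before[of u] 1 t by (intro bexI[of _ u]) auto
    next
      case 2
      then obtain u where "u\<in>{s..t}" "?Z u = v u" using ZO'[of s t] after s t st by auto
      then show ?thesis using after[of u] 2 t by (intro bexI[of _ u]) auto
    next
      case 3
      have m: "?X ?\<rho> = ?Z ?\<rho>" using 3 t by (intro first_meeting_meets[OF X Z]) auto
      consider "v ?\<rho> = ?Z ?\<rho>" | "v ?\<rho> < ?X ?\<rho>" | "?Z ?\<rho> < v ?\<rho>" using m by linarith
      then show ?thesis
      proof cases
        case 1
        then show ?thesis using after[of ?\<rho>] 3 t by (intro bexI[of _ ?\<rho>]) auto
      next
        case 2
        then obtain u where u: "u\<in>{s..?\<rho>}" "?X u = v u"
          using XO'[of s ?\<rho>] before[of s] s 3 t st by auto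
        have "?Y u = v u" using before[of u] after[of u] u 3 t m by (cases "u = ?\<rho>") auto
        then show ?thesis using u 3 by (intro bexI[of _ u]) auto
      next
        case 3
        note 4 = \<open>s < ?\<rho>\<close> \<open>?\<rho> \<le> t\<close>
        obtain u where u: "u\<in>{?\<rho>..t}" "?Z u = v u"
          using ZO'[of ?\<rho> t] after[of t] s 3 4 t st by auto
        then show ?thesis using after[of u] 4 t by (intro bexI[of _ u]) auto
      qed
    qed
  qed
qed

text \<open>
  A particle that has not met the coalesced path below it cannot have crossed it; a particle that has
  met it coincides with it at time \<open>T\<close>.
\<close>
lemma coalesced_ordered:
  assumes reg: "\<And>j. j < n \<Longrightarrow> w j \<in> R"
    and ord: "\<And>i j. i < n \<Longrightarrow> j < n \<Longrightarrow> order_changes_only_by_meeting T (w i) (w j)"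
    and start: "\<And>i j. i < j \<Longrightarrow> j < n \<Longrightarrow> w i 0 < w j 0"
    and ij: "i \<le> j" "j < n"
  shows "coalesced w i T \<le> coalesced w j T"
  using ij
proof (induction j rule: dec_induct)
  case (step j)
  let ?Z = "coalesced w j" and ?X = "w (Suc j)"
  have "?Z T \<le> coalesced w (Suc j) T"
  proof (rule ccontr)
    assume "\<not> ?thesis"
    then have no: "\<not> (\<exists>s\<in>{0..T}. ?X s = ?Z s)" and lt: "?X T < ?Z T"
      by (auto simp: coalesced.simps(2) split: if_splits)
    have "order_changes_only_by_meeting T ?Z ?X"
      using reg ord step by (intro coalesced_order_changes_only_by_meeting) auto
    moreover have "?Z 0 < ?X 0" using start[of j "Suc j"] step by (simp add: coalesced_zero)
    ultimately have "\<exists>u\<in>{0..T}. ?Z u = ?X u"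
      using lt T_pos unfolding order_changes_only_by_meeting_def by (auto dest!: bspec[of _ _ 0] bspec[of _ _ T])
    with no show False by metis
  qed
  then show ?case using step by simp
qed simp

end

section \<open>Continuous paths and nearest-neighbour jump paths\<close>

text \<open>
  The distance of two continuous paths attains its minimum on \<open>{0..t}\<close>, which is zero if the paths come
  arbitrarily close.
\<close>
lemma path_class_continuous:
  assumes T: "0 < T"
  shows "path_class T {w. continuous_on {0..T} w}"
proof
  show "0 < T" by (rule T)
next
  fix w :: "real \<Rightarrow> real" and t assume w: "w \<in> {w. continuous_on {0..T} w}" and t: "0 \<le> t" "t < T"
  have "(w \<longlongrightarrow> w t) (at t within {t..T})"
  proof (rule tendsto_within_subset)
    show "(w \<longlongrightarrow> w t) (at t within {0..T})" using w t by (simp add: continuous_on_def)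
    show "{t..T} \<subseteq> {0..T}" using t by simp
  qed
  then show "(w \<longlongrightarrow> w t) (at_right t)" using t by (simp add: at_within_Icc_at_right)
next
  fix v w :: "real \<Rightarrow> real" and t
  assume v: "v \<in> {w. continuous_on {0..T} w}" and w: "w \<in> {w. continuous_on {0..T} w}"
    and t: "0 \<le> t" "t \<le> T" and nm: "nearly_meet t v w"
  have "continuous_on {0..t} (\<lambda>s. \<bar>v s - w s\<bar>)"
    using v w t by (intro continuous_intros) (auto intro: continuous_on_subset)
  then obtain s where s: "s \<in> {0..t}" "\<And>r. r \<in> {0..t} \<Longrightarrow> \<bar>v s - w s\<bar> \<le> \<bar>v r - w r\<bar>"
    using continuous_attains_inf[of "{0..t}" "\<lambda>s. \<bar>v s - w s\<bar>"] t by auto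
  have "\<bar>v s - w s\<bar> \<le> 1 / (real m + 1)" for m
  proof -
    obtain r where r: "r \<in> {0..t} \<inter> \<rat> \<union> {t}" "\<bar>v r - w r\<bar> < 1 / (real m + 1)"
      using nm unfolding nearly_meet_def by blast
    then have "r \<in> {0..t}" using t by auto
    from s(2)[OF this] r(2) show ?thesis by simp
  qed
  then have "\<bar>v s - w s\<bar> \<le> 0"
    using tendsto_lowerbound[OF LIMSEQ_inverse_real_of_nat, of "\<bar>v s - w s\<bar>"]
    by (simp add: inverse_eq_divide add.commute)
  with s(1) show "\<exists>s\<in>{0..t}. v s = w s" by (intro bexI[of _ s]) simp_all
next
  fix v w :: "real \<Rightarrow> real" and s
  assume v: "v \<in> {w. continuous_on {0..T} w}" and w: "w \<in> {w. continuous_on {0..T} w}"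
    and s: "0 \<le> s" "s \<le> T" "v s = w s"
  have "continuous_on {0..T} (\<lambda>t. if t \<le> s then v t else w t)"
    by (rule continuous_on_cases_le) (use v w s in \<open>auto intro: continuous_on_subset\<close>)
  moreover have "(\<lambda>t. if t \<le> s then v t else w t) = (\<lambda>t. if t < s then v t else w t)"
    using s(3) by (auto simp: fun_eq_iff)
  ultimately show "(\<lambda>t. if t < s then v t else w t) \<in> {w. continuous_on {0..T} w}"
    by (simp only: mem_Collect_eq)
next
  fix v w :: "real \<Rightarrow> real"
  assume "w \<in> {w. continuous_on {0..T} w}" "\<And>t. 0 \<le> t \<Longrightarrow> t \<le> T \<Longrightarrow> v t = w t"
  then show "v \<in> {w. continuous_on {0..T} w}"
    using continuous_on_cong[of "{0..T}" "{0..T}" v w] by simp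
qed

text \<open>
  The part of the neighbour-jump condition that survives coalescence: the class must be closed under
  switching paths at a meeting, and finiteness of the range makes \<^const>\<open>nearly_meet\<close> exact.
\<close>
definition step_paths :: "real \<Rightarrow> (real \<Rightarrow> real) set" where
  "step_paths T = {w. (\<forall>t\<in>{0..<T}. \<forall>\<^sub>F u in at_right t. w u = w t) \<and> finite (w ` {0..T})}"

lemma path_class_step:
  assumes T: "0 < T"
  shows "path_class T (step_paths T)"
proof
  show "0 < T" by (rule T)
next
  fix w :: "real \<Rightarrow> real" and t assume "w \<in> step_paths T" "0 \<le> t" "t < T"
  then show "(w \<longlongrightarrow> w t) (at_right t)" by (intro tendsto_eventually) (simp add: step_paths_def)
next
  fix v w :: "real \<Rightarrow> real" and t
  assume v: "v \<in> step_paths T" and w: "w \<in> step_paths T"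
    and t: "0 \<le> t" "t \<le> T" and nm: "nearly_meet t v w"
  let ?D = "(\<lambda>s. \<bar>v s - w s\<bar>) ` {0..t}"
  have "?D \<subseteq> (\<lambda>(a, b). \<bar>a - b\<bar>) ` (v ` {0..T} \<times> w ` {0..T})" using t by force
  then have fin: "finite ?D"
    by (rule finite_subset) (use v w in \<open>simp add: step_paths_def\<close>)
  have ne: "?D \<noteq> {}" using t by simp
  obtain s where s: "s \<in> {0..t}" "Min ?D = \<bar>v s - w s\<bar>" using Min_in[OF fin ne] by auto
  have "v s = w s"
  proof (rule ccontr)
    assume "v s \<noteq> w s"
    then have "0 < \<bar>v s - w s\<bar>" by simp
    then obtain m :: nat where m: "1 / (real m + 1) < \<bar>v s - w s\<bar>"
      using reals_Archimedean[of "\<bar>v s - w s\<bar>"] by (auto simp: inverse_eq_divide add.commute)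
    obtain r where r: "r \<in> {0..t} \<inter> \<rat> \<union> {t}" "\<bar>v r - w r\<bar> < 1 / (real m + 1)"
      using nm unfolding nearly_meet_def by blast
    then have "r \<in> {0..t}" using t by auto
    then have "Min ?D \<le> \<bar>v r - w r\<bar>" by (intro Min_le[OF fin]) (rule imageI)
    with s m r show False by linarith
  qed
  with s(1) show "\<exists>s\<in>{0..t}. v s = w s" by (rule bexI[rotated])
next
  fix v w :: "real \<Rightarrow> real" and s
  assume v: "v \<in> step_paths T" and w: "w \<in> step_paths T" and s: "0 \<le> s" "s \<le> T" "v s = w s"
  let ?f = "\<lambda>t. if t < s then v t else w t"
  have "?f ` {0..T} \<subseteq> v ` {0..T} \<union> w ` {0..T}" by auto
  then have "finite (?f ` {0..T})" by (rule finite_subset) (use v w in \<open>simp add: step_paths_def\<close>)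
  moreover have "\<forall>\<^sub>F u in at_right t. ?f u = ?f t" if t: "t \<in> {0..<T}" for t
  proof (cases "t < s")
    case True
    have "\<forall>\<^sub>F u in at_right t. v u = v t" using v t by (simp add: step_paths_def)
    moreover have "\<forall>\<^sub>F u in at_right t. u < s"
      unfolding eventually_at_right_field using True by blast
    ultimately show ?thesis by eventually_elim (simp add: True)
  next
    case False
    have "\<forall>\<^sub>F u in at_right t. w u = w t" using w t by (simp add: step_paths_def)
    moreover have "\<forall>\<^sub>F u in at_right t. t < u" by (rule eventually_at_right_less)
    ultimately show ?thesis by eventually_elim (use False in simp)
  qed
  ultimately show "?f \<in> step_paths T" by (simp add: step_paths_def)
next
  fix v w :: "real \<Rightarrow> real"
  assume w: "w \<in> step_paths T" and eq: "\<And>t. 0 \<le> t \<Longrightarrow> t \<le> T \<Longrightarrow> v t = w t"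
  have "v ` {0..T} = w ` {0..T}" using eq by (intro image_cong) auto
  moreover have "\<forall>\<^sub>F u in at_right t. v u = v t" if t: "t \<in> {0..<T}" for t
  proof -
    have "\<forall>\<^sub>F u in at_right t. w u = w t" using w t by (simp add: step_paths_def)
    moreover have "\<forall>\<^sub>F u in at_right t. t < u" by (rule eventually_at_right_less)
    moreover have "\<forall>\<^sub>F u in at_right t. u < T"
      unfolding eventually_at_right_field using t by (intro exI[of _ T]) simp
    ultimately show ?thesis by eventually_elim (use t eq in simp)
  qed
  ultimately show "v \<in> step_paths T" using w by (simp add: step_paths_def)
qed

text \<open>
  Around each time such a path takes at most two values; compactness of \<open>{0..T}\<close> does the rest.
\<close>
lemma neighbour_jump_path_step:
  assumes w: "neighbour_jump_path T S w" and T: "0 < T"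
  shows "w \<in> step_paths T"
proof -
  have right: "\<forall>\<^sub>F u in at_right t. w u = w t" if "t \<in> {0..<T}" for t
    using w that unfolding neighbour_jump_path_def by blast
  have local: "\<exists>U. open U \<and> t \<in> U \<and> finite (w ` (U \<inter> {0..T}))" if t: "t \<in> {0..T}" for t
  proof -
    have "\<exists>b<t. \<exists>a. \<forall>u\<in>{0..T}. b < u \<and> u < t \<longrightarrow> w u = a"
    proof (cases "t = 0")
      case True
      then show ?thesis by (intro exI[of _ "- 1"]) auto
    next
      case False
      then obtain a where "\<forall>\<^sub>F u in at_left t. w u = a"
        using w t unfolding neighbour_jump_path_def by force
      then show ?thesis unfolding eventually_at_left_field by blast
    qed
    then obtain b a where b: "b < t" "\<And>u. u \<in> {0..T} \<Longrightarrow> b < u \<Longrightarrow> u < t \<Longrightarrow> w u = a" by blast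
    have "\<exists>c>t. \<forall>u\<in>{0..T}. t < u \<and> u < c \<longrightarrow> w u = w t"
    proof (cases "t = T")
      case True
      then show ?thesis by (intro exI[of _ "T + 1"]) auto
    next
      case False
      then have "\<forall>\<^sub>F u in at_right t. w u = w t" using t by (intro right) auto
      then show ?thesis unfolding eventually_at_right_field by blast
    qed
    then obtain c where c: "t < c" "\<And>u. u \<in> {0..T} \<Longrightarrow> t < u \<Longrightarrow> u < c \<Longrightarrow> w u = w t" by blast
    have "w ` ({b<..<c} \<inter> {0..T}) \<subseteq> {a, w t}"
    proof
      fix z assume "z \<in> w ` ({b<..<c} \<inter> {0..T})"
      then obtain u where u: "z = w u" "b < u" "u < c" "u \<in> {0..T}" by auto
      show "z \<in> {a, w t}" using b(2)[OF u(4,2)] c(2)[OF u(4) _ u(3)] u(1) by (cases u t rule: linorder_cases) auto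
    qed
    then have "finite (w ` ({b<..<c} \<inter> {0..T}))" by (rule finite_subset) simp
    with b c show ?thesis by (intro exI[of _ "{b<..<c}"]) simp
  qed
  then obtain U where U: "\<And>t. t \<in> {0..T} \<Longrightarrow> open (U t)" "\<And>t. t \<in> {0..T} \<Longrightarrow> t \<in> U t"
    "\<And>t. t \<in> {0..T} \<Longrightarrow> finite (w ` (U t \<inter> {0..T}))" by metis
  obtain C where C: "C \<subseteq> {0..T}" "finite C" "{0..T} \<subseteq> (\<Union>t\<in>C. U t)"
    using compactE_image[of "{0..T}" "{0..T}" U] U(1,2) compact_Icc by blast
  have "w ` {0..T} \<subseteq> (\<Union>t\<in>C. w ` (U t \<inter> {0..T}))" using C(3) by blast
  moreover have "finite (\<Union>t\<in>C. w ` (U t \<inter> {0..T}))" using C U(3) by (intro finite_UN_I) auto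
  ultimately have "finite (w ` {0..T})" by (rule finite_subset)
  with right show ?thesis by (simp add: step_paths_def)
qed

section \<open>Measurability\<close>

lemma borel_measurable_pred_le:
  fixes f g :: "'a \<Rightarrow> real"
  assumes [measurable]: "f \<in> borel_measurable N" "g \<in> borel_measurable N"
  shows "Measurable.pred N (\<lambda>\<omega>. f \<omega> \<le> g \<omega>)"
  by measurable

lemma measurable_nearly_meet:
  assumes "\<And>s. 0 \<le> s \<Longrightarrow> s \<le> t \<Longrightarrow> V s \<in> borel_measurable N"
    and "\<And>s. 0 \<le> s \<Longrightarrow> s \<le> t \<Longrightarrow> W s \<in> borel_measurable N" and "0 \<le> t"
  shows "Measurable.pred N (\<lambda>\<omega>. nearly_meet t (\<lambda>s. V s \<omega>) (\<lambda>s. W s \<omega>))"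
proof -
  have cnt: "countable ({0..t} \<inter> \<rat> \<union> {t})"
    by (simp add: countable_rat)
  have "Measurable.pred N (\<lambda>\<omega>. \<bar>V r \<omega> - W r \<omega>\<bar> < 1 / (real m + 1))"
    if "r \<in> {0..t} \<inter> \<rat> \<union> {t}" for r and m :: nat
  proof -
    have [measurable]: "V r \<in> borel_measurable N" "W r \<in> borel_measurable N" using assms that by auto
    show ?thesis by measurable
  qed
  then show ?thesis
    unfolding nearly_meet_def pred_def
    by (intro sets.sets_Collect_countable_All sets.sets_Collect_countable_Ex'[OF _ cnt]) auto
qed

lemma measurable_approx_coalesced:
  assumes "\<And>j s. j \<le> i \<Longrightarrow> 0 \<le> s \<Longrightarrow> s \<le> t \<Longrightarrow> V j s \<in> borel_measurable N" and "0 \<le> t"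
  shows "(\<lambda>\<omega>. approx_coalesced (\<lambda>j s. V j s \<omega>) i t) \<in> borel_measurable N"
  using assms
proof (induction i arbitrary: t)
  case (Suc i)
  have Z: "(\<lambda>\<omega>. approx_coalesced (\<lambda>j s. V j s \<omega>) i s) \<in> borel_measurable N" if "0 \<le> s" "s \<le> t" for s
    using Suc.prems(1) that by (intro Suc.IH) auto
  have [measurable]: "Measurable.pred N
      (\<lambda>\<omega>. nearly_meet t (\<lambda>s. V (Suc i) s \<omega>) (approx_coalesced (\<lambda>j s. V j s \<omega>) i))"
    using Z Suc.prems
      measurable_nearly_meet[of t "V (Suc i)" N "\<lambda>s \<omega>. approx_coalesced (\<lambda>j s. V j s \<omega>) i s"]
    by auto
  have [measurable]: "(\<lambda>\<omega>. approx_coalesced (\<lambda>j s. V j s \<omega>) i t) \<in> borel_measurable N"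
    "V (Suc i) t \<in> borel_measurable N"
    using Z[of t] Suc.prems by auto
  show ?case unfolding approx_coalesced.simps(2) by measurable
qed auto

text \<open>
  Approximate the random time from the right by times with countably many values.
\<close>
lemma measurable_at_random_time:
  fixes W :: "real \<Rightarrow> 'a \<Rightarrow> real"
  assumes W: "\<And>s. 0 \<le> s \<Longrightarrow> s \<le> t \<Longrightarrow> W s \<in> borel_measurable N"
    and \<tau>: "\<tau> \<in> borel_measurable N" "\<And>\<omega>. \<omega> \<in> space N \<Longrightarrow> 0 \<le> \<tau> \<omega> \<and> \<tau> \<omega> \<le> t"
    and rc: "\<And>\<omega> s. \<omega> \<in> space N \<Longrightarrow> 0 \<le> s \<Longrightarrow> s < t \<Longrightarrow> ((\<lambda>u. W u \<omega>) \<longlongrightarrow> W s \<omega>) (at_right s)"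
    and t: "0 \<le> t"
  shows "(\<lambda>\<omega>. W (\<tau> \<omega>) \<omega>) \<in> borel_measurable N"
proof -
  \<comment> \<open>The next multiple of \<open>1 / (m + 1)\<close> after the random time, kept within \<open>{0..t}\<close>.\<close>
  define c :: "nat \<Rightarrow> int \<Rightarrow> real" where "c m i = max 0 (min t ((of_int i + 1) / (real m + 1)))" for m i
  define g :: "nat \<Rightarrow> 'a \<Rightarrow> int" where "g m \<omega> = \<lfloor>(real m + 1) * \<tau> \<omega>\<rfloor>" for m \<omega>
  have "(\<lambda>\<omega>. W (c m (g m \<omega>)) \<omega>) \<in> borel_measurable N" for m
  proof (rule measurable_compose_countable)
    show "W (c m i) \<in> borel_measurable N" for i
      by (rule W) (use t in \<open>auto simp: c_def\<close>)
    show "g m \<in> measurable N (count_space UNIV)"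
      unfolding g_def using \<tau>(1) by measurable
  qed
  moreover have "(\<lambda>m. W (c m (g m \<omega>)) \<omega>) \<longlonglongrightarrow> W (\<tau> \<omega>) \<omega>" if \<omega>: "\<omega> \<in> space N" for \<omega>
  proof (cases "\<tau> \<omega> = t")
    case True
    have "c m (g m \<omega>) = t" for m
    proof -
      have "(real m + 1) * \<tau> \<omega> < of_int (g m \<omega>) + 1" unfolding g_def by linarith
      then have "t \<le> (of_int (g m \<omega>) + 1) / (real m + 1)" using True by (simp add: field_simps)
      then show ?thesis using t by (simp add: c_def)
    qed
    then show ?thesis using True by simp
  next
    case False
    then have lt: "\<tau> \<omega> < t" using \<tau>(2)[OF \<omega>] by simp
    have lo: "\<tau> \<omega> < (of_int (g m \<omega>) + 1) / (real m + 1)" for m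
    proof -
      have "(real m + 1) * \<tau> \<omega> < of_int (g m \<omega>) + 1" unfolding g_def by linarith
      then show ?thesis by (simp add: field_simps)
    qed
    have hi: "(of_int (g m \<omega>) + 1) / (real m + 1) \<le> \<tau> \<omega> + 1 / (real m + 1)" for m
    proof -
      have "of_int (g m \<omega>) \<le> (real m + 1) * \<tau> \<omega>" unfolding g_def by linarith
      then have "of_int (g m \<omega>) / (real m + 1) \<le> \<tau> \<omega>" by (simp add: field_simps)
      then show ?thesis by (simp add: add_divide_distrib)
    qed
    have gt: "\<tau> \<omega> < c m (g m \<omega>)" for m
      using lo[of m] lt by (auto simp: c_def)
    have le: "c m (g m \<omega>) \<le> \<tau> \<omega> + 1 / (real m + 1)" for m
      using hi[of m] \<tau>(2)[OF \<omega>] by (auto simp: c_def intro: min.coboundedI2)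
    have "(\<lambda>m. c m (g m \<omega>)) \<longlonglongrightarrow> \<tau> \<omega>"
    proof (rule tendsto_sandwich[of "\<lambda>_. \<tau> \<omega>" _ _ "\<lambda>m. \<tau> \<omega> + 1 / (real m + 1)"])
      show "(\<lambda>m. \<tau> \<omega> + 1 / (real m + 1)) \<longlonglongrightarrow> \<tau> \<omega>"
        using tendsto_add[OF tendsto_const[of "\<tau> \<omega>"] LIMSEQ_inverse_real_of_nat]
        by (simp add: inverse_eq_divide add.commute)
    qed (use gt le in \<open>auto intro!: always_eventually simp: less_imp_le\<close>)
    then have "filterlim (\<lambda>m. c m (g m \<omega>)) (at_right (\<tau> \<omega>)) sequentially"
      by (rule tendsto_imp_filterlim_at_right) (use gt in auto)
    from filterlim_compose[OF rc[OF \<omega> _ lt] this] show ?thesis using \<tau>(2)[OF \<omega>] by simp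
  qed
  ultimately show ?thesis by (rule borel_measurable_LIMSEQ_real[rotated])
qed

definition bounded_measurable :: "'a measure \<Rightarrow> ('a \<Rightarrow> real) \<Rightarrow> bool" where
  "bounded_measurable N f \<longleftrightarrow> f \<in> borel_measurable N \<and> (\<exists>C. \<forall>\<omega>\<in>space N. \<bar>f \<omega>\<bar> \<le> C)"

lemma bounded_measurableI:
  "f \<in> borel_measurable N \<Longrightarrow> (\<And>\<omega>. \<omega> \<in> space N \<Longrightarrow> \<bar>f \<omega>\<bar> \<le> C) \<Longrightarrow> bounded_measurable N f"
  unfolding bounded_measurable_def by auto

lemma bounded_measurable_const: "bounded_measurable N (\<lambda>_. c)"
  by (rule bounded_measurableI[of _ _ "\<bar>c\<bar>"]) auto

lemma bounded_measurable_add: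
  assumes "bounded_measurable N f" "bounded_measurable N g"
  shows "bounded_measurable N (\<lambda>\<omega>. f \<omega> + g \<omega>)"
proof -
  obtain C D where "\<And>\<omega>. \<omega>\<in>space N \<Longrightarrow> \<bar>f \<omega>\<bar> \<le> C" "\<And>\<omega>. \<omega>\<in>space N \<Longrightarrow> \<bar>g \<omega>\<bar> \<le> D"
    using assms unfolding bounded_measurable_def by blast
  then show ?thesis
    using assms by (intro bounded_measurableI[of _ _ "C + D"])
      (fastforce simp: bounded_measurable_def intro: abs_triangle_ineq[THEN order_trans] add_mono)+
qed

lemma bounded_measurable_mult:
  assumes "bounded_measurable N f" "bounded_measurable N g"
  shows "bounded_measurable N (\<lambda>\<omega>. f \<omega> * g \<omega>)"
proof -
  obtain C D where *: "\<And>\<omega>. \<omega>\<in>space N \<Longrightarrow> \<bar>f \<omega>\<bar> \<le> C" "\<And>\<omega>. \<omega>\<in>space N \<Longrightarrow> \<bar>g \<omega>\<bar> \<le> D"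
    using assms unfolding bounded_measurable_def by blast
  have "\<bar>f \<omega> * g \<omega>\<bar> \<le> C * D" if "\<omega> \<in> space N" for \<omega>
    unfolding abs_mult using *(1)[OF that] *(2)[OF that] by (intro mult_mono) auto
  then show ?thesis
    using assms by (intro bounded_measurableI[of _ _ "C * D"]) (auto simp: bounded_measurable_def)
qed

lemma bounded_measurable_diff:
  assumes "bounded_measurable N f" "bounded_measurable N g"
  shows "bounded_measurable N (\<lambda>\<omega>. f \<omega> - g \<omega>)"
  using bounded_measurable_add[OF assms(1)
      bounded_measurable_mult[OF bounded_measurable_const[of N "-1"] assms(2)]] by simp

lemma bounded_measurable_sum:
  "(\<And>i. i \<in> I \<Longrightarrow> bounded_measurable N (f i)) \<Longrightarrow> bounded_measurable N (\<lambda>\<omega>. \<Sum>i\<in>I. f i \<omega>)"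
  by (induction I rule: infinite_finite_induct)
     (auto intro: bounded_measurable_const bounded_measurable_add)

lemma bounded_measurable_prod:
  "(\<And>i. i \<in> I \<Longrightarrow> bounded_measurable N (f i)) \<Longrightarrow> bounded_measurable N (\<lambda>\<omega>. \<Prod>i\<in>I. f i \<omega>)"
  by (induction I rule: infinite_finite_induct)
     (auto intro: bounded_measurable_const bounded_measurable_mult)

lemma bounded_measurable_of_bool:
  "Measurable.pred N P \<Longrightarrow> bounded_measurable N (\<lambda>\<omega>. of_bool (P \<omega>))"
  by (rule bounded_measurableI[of _ _ 1]) (auto simp: of_bool_def)

lemma borel_measurable_of_bool_pred:
  "Measurable.pred N P \<Longrightarrow> (\<lambda>\<omega>. of_bool (P \<omega>) :: real) \<in> borel_measurable N"
  using bounded_measurable_of_bool[where N = N and P = P] unfolding bounded_measurable_def by blast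

lemma bounded_measurable_rows_det:
  assumes "\<And>i j. i < n \<Longrightarrow> j < n \<Longrightarrow> bounded_measurable N (\<lambda>\<omega>. r \<omega> i j)"
  shows "bounded_measurable N (\<lambda>\<omega>. rows_det n (r \<omega>))"
  unfolding rows_det_perm
  using assms permutes_in_image
  by (intro bounded_measurable_sum bounded_measurable_mult bounded_measurable_const
      bounded_measurable_prod) fastforce

lemma (in finite_measure) integrable_bounded_measurable:
  assumes "bounded_measurable M f"
  shows "integrable M f"
proof -
  obtain C where "f \<in> borel_measurable M" "\<And>\<omega>. \<omega> \<in> space M \<Longrightarrow> \<bar>f \<omega>\<bar> \<le> C"
    using assms unfolding bounded_measurable_def by blast
  then show ?thesis by (intro integrable_const_bound[of _ C]) auto
qed

section \<open>The strong Markov property of one particle\<close>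

lemma space_natural_filtration: "space (natural_filtration M S X t) = space M"
  unfolding natural_filtration_def by (rule space_measure_of) auto

lemma sets_natural_filtration:
  "sets (natural_filtration M S X t) =
     sigma_sets (space M) (\<Union>s\<in>{0..t}. {X s -` B \<inter> space M | B. B \<in> sets (restrict_space borel S)})"
  unfolding natural_filtration_def by (rule sets_measure_of) auto

lemma filtration_natural: "filtration (space M) (natural_filtration M S X)"
proof
  show "space (natural_filtration M S X i) = space M" for i by (rule space_natural_filtration)
  show "sets (natural_filtration M S X i) \<subseteq> sets (natural_filtration M S X j)" if "i \<le> j" for i j
    unfolding sets_natural_filtration using that by (intro sigma_sets_mono') force
qed

lemma natural_filtration_subset:
  assumes "\<And>s. 0 \<le> s \<Longrightarrow> s \<le> t \<Longrightarrow> X s \<in> M \<rightarrow>\<^sub>M restrict_space borel S"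
  shows "sets (natural_filtration M S X t) \<subseteq> sets M"
  unfolding sets_natural_filtration
  by (rule sets.sigma_sets_subset) (use assms in \<open>auto intro!: measurable_sets\<close>)

lemma measurable_natural_filtration:
  assumes "X s \<in> M \<rightarrow>\<^sub>M restrict_space borel S" "0 \<le> s" "s \<le> t"
  shows "X s \<in> natural_filtration M S X t \<rightarrow>\<^sub>M restrict_space borel S"
proof (rule measurableI)
  show "X s \<omega> \<in> space (restrict_space borel S)" if "\<omega> \<in> space (natural_filtration M S X t)" for \<omega>
    using measurable_space[OF assms(1)] that by (simp add: space_natural_filtration)
  show "X s -` B \<inter> space (natural_filtration M S X t) \<in> sets (natural_filtration M S X t)"
    if "B \<in> sets (restrict_space borel S)" for B
    unfolding space_natural_filtration unfolding sets_natural_filtration using assms that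
    by (intro sigma_sets.Basic UN_I[of s] CollectI exI[of _ B]) auto
qed

text \<open>
  The conditional expectation in the strong Markov property, tested against a bounded function of the
  past.
\<close>
lemma (in prob_space) strong_markov_integral:
  assumes sm: "strong_markov_process M T S \<kappa> X" and T: "0 \<le> T"
    and st: "stopping_time (natural_filtration M S X) \<tau>" "\<And>\<omega>. \<omega> \<in> space M \<Longrightarrow> 0 \<le> \<tau> \<omega> \<and> \<tau> \<omega> \<le> T"
    and \<Phi>: "bounded_measurable (filtration.pre_sigma (space M) (natural_filtration M S X) \<tau>) \<Phi>"
    and B: "B \<in> sets (restrict_space borel S)"
    and meas: "(\<lambda>\<omega>. measure (\<kappa> (\<tau> \<omega>) T (X (\<tau> \<omega>) \<omega>)) B) \<in> borel_measurable M"
  shows "(\<integral>\<omega>. \<Phi> \<omega> * indicator (X T -` B \<inter> space M) \<omega> \<partial>M)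
       = (\<integral>\<omega>. \<Phi> \<omega> * measure (\<kappa> (\<tau> \<omega>) T (X (\<tau> \<omega>) \<omega>)) B \<partial>M)"
proof -
  interpret F: filtration "space M" "natural_filtration M S X" by (rule filtration_natural)
  let ?F = "F.pre_sigma \<tau>"
  let ?I = "indicator (X T -` B \<inter> space M) :: 'a \<Rightarrow> real"
  have X: "X s \<in> M \<rightarrow>\<^sub>M restrict_space borel S" if "0 \<le> s" "s \<le> T" for s
    using sm that by (auto simp: strong_markov_process_def)
  have "sets ?F \<subseteq> sets M"
  proof
    fix A assume A: "A \<in> sets ?F"
    then have "A \<subseteq> space M" using sets.sets_into_space[OF A] by (simp add: F.space_pre_sigma)
    then have "{\<omega> \<in> A. \<tau> \<omega> \<le> T} = A" using st(2) by auto
    then have "A \<in> sets (natural_filtration M S X T)" using F.sets_pre_sigmaD[OF st(1) A, of T] by simp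
    then show "A \<in> sets M" using natural_filtration_subset[of T X M S] X by auto
  qed
  then have sub: "subalgebra M ?F" by (simp add: subalgebra_def F.space_pre_sigma)
  interpret finite_measure_subalgebra M ?F by standard (rule sub)
  have ev: "X T -` B \<inter> space M \<in> events" using measurable_sets[OF X[of T] B] T by simp
  have \<Phi>': "bounded_measurable M \<Phi>"
    using \<Phi> measurable_from_subalg[OF sub, of \<Phi> borel]
    unfolding bounded_measurable_def F.space_pre_sigma by blast
  have "bounded_measurable M ?I" using ev by (intro bounded_measurableI[of _ _ 1]) (auto simp: indicator_def)
  then have int: "integrable M (\<lambda>\<omega>. \<Phi> \<omega> * ?I \<omega>)"
    by (intro integrable_bounded_measurable bounded_measurable_mult \<Phi>')
  have "(\<integral>\<omega>. \<Phi> \<omega> * ?I \<omega> \<partial>M) = (\<integral>\<omega>. \<Phi> \<omega> * real_cond_exp M ?F ?I \<omega> \<partial>M)"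
  proof (rule real_cond_exp_intg(2)[OF int, symmetric])
    show "\<Phi> \<in> borel_measurable ?F" using \<Phi> unfolding bounded_measurable_def by blast
    show "?I \<in> borel_measurable M" using ev by (rule borel_measurable_indicator)
  qed
  also have "\<dots> = (\<integral>\<omega>. \<Phi> \<omega> * measure (\<kappa> (\<tau> \<omega>) T (X (\<tau> \<omega>) \<omega>)) B \<partial>M)"
  proof (rule integral_cong_AE)
    have "AE \<omega> in M. real_cond_exp M ?F ?I \<omega> = measure (\<kappa> (\<tau> \<omega>) T (X (\<tau> \<omega>) \<omega>)) B"
      using sm[unfolded strong_markov_process_def, THEN conjunct2, rule_format, of T B \<tau>] st B T
      by (simp add: atLeastAtMost_iff)
    then show "AE \<omega> in M. \<Phi> \<omega> * real_cond_exp M ?F ?I \<omega> = \<Phi> \<omega> * measure (\<kappa> (\<tau> \<omega>) T (X (\<tau> \<omega>) \<omega>)) B"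
      by eventually_elim simp
    have [measurable]: "\<Phi> \<in> borel_measurable M" using \<Phi>' unfolding bounded_measurable_def by blast
    show "(\<lambda>\<omega>. \<Phi> \<omega> * real_cond_exp M ?F ?I \<omega>) \<in> borel_measurable M"
      by (intro borel_measurable_times borel_measurable_cond_exp2) fact
    show "(\<lambda>\<omega>. \<Phi> \<omega> * measure (\<kappa> (\<tau> \<omega>) T (X (\<tau> \<omega>) \<omega>)) B) \<in> borel_measurable M"
      by (intro borel_measurable_times meas) fact
  qed
  finally show ?thesis .
qed

section \<open>Independent random elements on a product space\<close>

lemma (in prob_space) distr_PiM_coordinatewise:
  assumes "finite I" and f: "\<And>i. f i \<in> M \<rightarrow>\<^sub>M N i"
  shows "distr (Pi\<^sub>M I (\<lambda>_. M)) (Pi\<^sub>M I N) (\<lambda>\<omega>. \<lambda>i\<in>I. f i (\<omega> i)) = Pi\<^sub>M I (\<lambda>i. distr M (N i) (f i))"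
proof -
  have N: "prob_space (distr M (N i) (f i))" for i by (rule prob_space_distr[OF f])
  interpret D: product_sigma_finite "\<lambda>i. distr M (N i) (f i)"
    unfolding product_sigma_finite_def by (intro allI prob_space_imp_sigma_finite N)
  interpret PS: product_sigma_finite "\<lambda>_. M" ..
  have sets: "sets (Pi\<^sub>M I (\<lambda>i. distr M (N i) (f i))) = sets (Pi\<^sub>M I N)"
    by (rule sets_PiM_cong) simp_all
  have meas: "(\<lambda>\<omega>. \<lambda>i\<in>I. f i (\<omega> i)) \<in> Pi\<^sub>M I (\<lambda>_. M) \<rightarrow>\<^sub>M Pi\<^sub>M I N"
  proof (rule measurable_restrict)
    fix i assume i: "i \<in> I"
    show "(\<lambda>\<omega>. f i (\<omega> i)) \<in> Pi\<^sub>M I (\<lambda>_. M) \<rightarrow>\<^sub>M N i"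
      by (rule measurable_compose[OF measurable_component_singleton[OF i] f])
  qed
  show ?thesis
  proof (rule D.PiM_eqI[OF assms(1)])
    fix A assume A: "\<And>i. i \<in> I \<Longrightarrow> A i \<in> sets (distr M (N i) (f i))"
    have pre: "(\<lambda>\<omega>. \<lambda>i\<in>I. f i (\<omega> i)) -` Pi\<^sub>E I A \<inter> space (Pi\<^sub>M I (\<lambda>_. M)) = Pi\<^sub>E I (\<lambda>i. f i -` A i \<inter> space M)"
      by (auto simp: space_PiM PiE_iff)
    have A': "A i \<in> sets (N i)" if "i \<in> I" for i using A[OF that] by simp
    have "Pi\<^sub>E I A \<in> sets (Pi\<^sub>M I N)" by (rule sets_PiM_I_finite[OF assms(1) A'])
    then have "emeasure (distr (Pi\<^sub>M I (\<lambda>_. M)) (Pi\<^sub>M I N) (\<lambda>\<omega>. \<lambda>i\<in>I. f i (\<omega> i))) (Pi\<^sub>E I A)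
        = emeasure (Pi\<^sub>M I (\<lambda>_. M)) (Pi\<^sub>E I (\<lambda>i. f i -` A i \<inter> space M))"
      unfolding pre[symmetric] by (rule emeasure_distr[OF meas])
    also have "\<dots> = (\<Prod>i\<in>I. emeasure M (f i -` A i \<inter> space M))"
      by (rule PS.emeasure_PiM[OF assms(1)]) (rule measurable_sets[OF f A'])
    also have "\<dots> = (\<Prod>i\<in>I. emeasure (distr M (N i) (f i)) (A i))"
      by (intro prod.cong refl emeasure_distr[symmetric] f A')
    finally show "emeasure (distr (Pi\<^sub>M I (\<lambda>_. M)) (Pi\<^sub>M I N) (\<lambda>\<omega>. \<lambda>i\<in>I. f i (\<omega> i))) (Pi\<^sub>E I A)
      = (\<Prod>i\<in>I. emeasure (distr M (N i) (f i)) (A i))" .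
  qed (simp only: sets_distr sets)
qed

text \<open>
  By independence the joint law is the product of the laws, and this product is also the joint law of
  the copies that live on separate coordinates.
\<close>
lemma (in prob_space) indep_vars_integral_product_copy:
  fixes g :: "('i \<Rightarrow> 'b) \<Rightarrow> real"
  assumes I: "finite I" "I \<noteq> {}" and ind: "indep_vars (\<lambda>_. N) f I"
    and g: "g \<in> borel_measurable (Pi\<^sub>M I (\<lambda>_. N))"
  shows "(\<integral>\<omega>. g (\<lambda>i\<in>I. f i \<omega>) \<partial>M) = (\<integral>\<omega>. g (\<lambda>i\<in>I. f i (\<omega> i)) \<partial>(Pi\<^sub>M I (\<lambda>_. M)))"
proof -
  have rv: "f i \<in> M \<rightarrow>\<^sub>M N" if "i \<in> I" for i using ind that unfolding indep_vars_def by blast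
  obtain i0 where i0: "i0 \<in> I" using I by blast
  \<comment> \<open>The product of the laws needs a random element for every index, also outside \<open>I\<close>.\<close>
  define f' where "f' i = (if i \<in> I then f i else f i0)" for i
  have rv': "f' i \<in> M \<rightarrow>\<^sub>M N" for i using rv i0 by (simp add: f'_def)
  have m1: "(\<lambda>\<omega>. \<lambda>i\<in>I. f i \<omega>) \<in> M \<rightarrow>\<^sub>M Pi\<^sub>M I (\<lambda>_. N)" by (rule measurable_restrict) (rule rv)
  have m2: "(\<lambda>\<omega>. \<lambda>i\<in>I. f' i (\<omega> i)) \<in> Pi\<^sub>M I (\<lambda>_. M) \<rightarrow>\<^sub>M Pi\<^sub>M I (\<lambda>_. N)"
  proof (rule measurable_restrict)
    fix i assume i: "i \<in> I"
    show "(\<lambda>\<omega>. f' i (\<omega> i)) \<in> Pi\<^sub>M I (\<lambda>_. M) \<rightarrow>\<^sub>M N"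
      by (rule measurable_compose[OF measurable_component_singleton[OF i] rv'])
  qed
  have "(\<integral>\<omega>. g (\<lambda>i\<in>I. f i \<omega>) \<partial>M) = (\<integral>w. g w \<partial>(distr M (Pi\<^sub>M I (\<lambda>_. N)) (\<lambda>\<omega>. \<lambda>i\<in>I. f i \<omega>)))"
    by (rule integral_distr[OF m1 g, symmetric])
  also have "distr M (Pi\<^sub>M I (\<lambda>_. N)) (\<lambda>\<omega>. \<lambda>i\<in>I. f i \<omega>) = Pi\<^sub>M I (\<lambda>i. distr M N (f i))"
    using indep_vars_iff_distr_eq_PiM'[OF I(2), of f "\<lambda>_. N"] rv ind by simp
  also have "\<dots> = Pi\<^sub>M I (\<lambda>i. distr M N (f' i))"
    by (intro PiM_cong refl) (simp add: f'_def)
  also have "\<dots> = distr (Pi\<^sub>M I (\<lambda>_. M)) (Pi\<^sub>M I (\<lambda>_. N)) (\<lambda>\<omega>. \<lambda>i\<in>I. f' i (\<omega> i))"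
    by (rule distr_PiM_coordinatewise[OF I(1) rv', symmetric])
  also have "(\<integral>w. g w \<partial>\<dots>) = (\<integral>\<omega>. g (\<lambda>i\<in>I. f' i (\<omega> i)) \<partial>(Pi\<^sub>M I (\<lambda>_. M)))"
    by (rule integral_distr[OF m2 g])
  also have "\<dots> = (\<integral>\<omega>. g (\<lambda>i\<in>I. f i (\<omega> i)) \<partial>(Pi\<^sub>M I (\<lambda>_. M)))"
    by (intro Bochner_Integration.integral_cong refl arg_cong[where f = g] restrict_ext) (simp add: f'_def)
  finally show ?thesis .
qed

section \<open>Particles on a product space and their joint past\<close>

text \<open>
  Particle \<open>k\<close> is going to be driven by coordinate \<open>k\<close> of the product space \<open>\<Omega>\<close> below. This makes the
  particles independent by construction.
\<close>
locale independent_particles = prob_space M + path_class T R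
  for M :: "'w measure" and T R +
  fixes S :: "real set" and \<kappa> :: "real \<Rightarrow> real \<Rightarrow> real \<Rightarrow> real measure" and n :: nat
    and X :: "nat \<Rightarrow> real \<Rightarrow> 'w \<Rightarrow> real" and y :: "nat \<Rightarrow> real"
  assumes transition: "transition_function T S \<kappa>"
    and markov: "k < n \<Longrightarrow> strong_markov_process M T S \<kappa> (X k)"
    and regular: "k < n \<Longrightarrow> \<omega> \<in> space M \<Longrightarrow> (\<lambda>t. X k t \<omega>) \<in> R"
begin

abbreviation \<Omega> :: "(nat \<Rightarrow> 'w) measure" where
  "\<Omega> \<equiv> Pi\<^sub>M {..<n} (\<lambda>_. M)"

text \<open>
  The joint past. As a product of natural filtrations it has sections in the natural filtration of
  each single particle, which is what the strong Markov property of that particle needs.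
\<close>
definition \<G> :: "real \<Rightarrow> (nat \<Rightarrow> 'w) measure" where
  "\<G> t = Pi\<^sub>M {..<n} (\<lambda>k. natural_filtration M S (X k) t)"

text \<open>
  The free particles; they are the driving paths of the coalescing particles \<open>Z\<close> below.
\<close>
definition Y :: "nat \<Rightarrow> real \<Rightarrow> (nat \<Rightarrow> 'w) \<Rightarrow> real" where
  "Y k t \<omega> = X k t (\<omega> k)"

definition Z :: "nat \<Rightarrow> real \<Rightarrow> (nat \<Rightarrow> 'w) \<Rightarrow> real" where
  "Z k t \<omega> = coalesced (\<lambda>j s. Y j s \<omega>) k t"

definition G :: "real \<Rightarrow> real \<Rightarrow> nat \<Rightarrow> real" where
  "G s p j = measure (\<kappa> s T p) {z \<in> S. z \<le> y j}"

text \<open>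
  Stopping times of the joint past with values in \<open>{0..T}\<close>. The past is only used up to time \<open>T\<close>,
  because the positions of the particles after \<open>T\<close> need not be measurable.
\<close>
definition observed_time :: "((nat \<Rightarrow> 'w) \<Rightarrow> real) \<Rightarrow> bool" where
  "observed_time \<sigma> \<longleftrightarrow> (\<forall>\<omega>\<in>space \<Omega>. 0 \<le> \<sigma> \<omega> \<and> \<sigma> \<omega> \<le> T) \<and>
     (\<forall>t\<in>{0..T}. Measurable.pred (\<G> t) (\<lambda>\<omega>. \<sigma> \<omega> \<le> t))"

text \<open>
  Boundedness together with measurability for the \<open>\<sigma>\<close>-algebra of the stopping time \<open>\<sigma>\<close>, expressed
  through the pasts at fixed times.
\<close>
definition known_at :: "((nat \<Rightarrow> 'w) \<Rightarrow> real) \<Rightarrow> ((nat \<Rightarrow> 'w) \<Rightarrow> real) \<Rightarrow> bool" where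
  "known_at \<sigma> f \<longleftrightarrow> (\<exists>C. \<forall>\<omega>\<in>space \<Omega>. \<bar>f \<omega>\<bar> \<le> C) \<and>
     (\<forall>t\<in>{0..T}. (\<lambda>\<omega>. of_bool (\<sigma> \<omega> \<le> t) * f \<omega>) \<in> borel_measurable (\<G> t))"

lemma prob_space_\<Omega>: "prob_space \<Omega>"
  by (rule prob_space_PiM) (rule prob_space_axioms)

lemma X_measurable: "k < n \<Longrightarrow> 0 \<le> t \<Longrightarrow> t \<le> T \<Longrightarrow> X k t \<in> M \<rightarrow>\<^sub>M restrict_space borel S"
  using markov by (auto simp: strong_markov_process_def)

lemma space_\<G>: "space (\<G> t) = space \<Omega>"
  by (simp add: \<G>_def space_PiM space_natural_filtration)

lemma measurable_\<G>_mono: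
  assumes "f \<in> \<G> s \<rightarrow>\<^sub>M N" "s \<le> t"
  shows "f \<in> \<G> t \<rightarrow>\<^sub>M N"
proof -
  have id: "(\<lambda>a. a) \<in> natural_filtration M S (X k) t \<rightarrow>\<^sub>M natural_filtration M S (X k) s" for k
  proof -
    have "subalgebra (natural_filtration M S (X k) t) (natural_filtration M S (X k) s)"
      unfolding subalgebra_def space_natural_filtration
      using filtration.sets_F_mono[OF filtration_natural assms(2)] by (intro conjI refl)
    from measurable_from_subalg[OF this measurable_ident] show ?thesis by (simp only: id_def)
  qed
  have "(\<lambda>\<omega>. \<lambda>k\<in>{..<n}. \<omega> k) \<in> \<G> t \<rightarrow>\<^sub>M \<G> s"
    unfolding \<G>_def
  proof (rule measurable_restrict)
    fix k assume "k \<in> {..<n}"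
    then have "(\<lambda>\<omega>. \<omega> k) \<in> Pi\<^sub>M {..<n} (\<lambda>k. natural_filtration M S (X k) t) \<rightarrow>\<^sub>M natural_filtration M S (X k) t"
      by (rule measurable_component_singleton)
    from measurable_compose[OF this id]
    show "(\<lambda>\<omega>. \<omega> k) \<in> Pi\<^sub>M {..<n} (\<lambda>k. natural_filtration M S (X k) t) \<rightarrow>\<^sub>M natural_filtration M S (X k) s" .
  qed
  from measurable_compose[OF this assms(1)]
  have *: "(\<lambda>\<omega>. f (restrict \<omega> {..<n})) \<in> \<G> t \<rightarrow>\<^sub>M N" .
  have eq: "f (restrict \<omega> {..<n}) = f \<omega>" if "\<omega> \<in> space (\<G> t)" for \<omega>
    using that by (simp add: space_\<G> space_PiM PiE_restrict)
  have "(\<lambda>\<omega>. f (restrict \<omega> {..<n})) \<in> \<G> t \<rightarrow>\<^sub>M N \<longleftrightarrow> f \<in> \<G> t \<rightarrow>\<^sub>M N"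
    by (rule measurable_cong) (rule eq)
  with * show ?thesis by (simp only:)
qed

lemma measurable_\<G>_T:
  assumes "f \<in> \<G> T \<rightarrow>\<^sub>M N"
  shows "f \<in> \<Omega> \<rightarrow>\<^sub>M N"
proof -
  have id: "(\<lambda>a. a) \<in> M \<rightarrow>\<^sub>M natural_filtration M S (X k) T" if "k < n" for k
  proof -
    have "subalgebra M (natural_filtration M S (X k) T)"
      unfolding subalgebra_def space_natural_filtration
      using natural_filtration_subset[OF X_measurable[OF that]] by (intro conjI refl)
    from measurable_from_subalg[OF this measurable_ident] show ?thesis by (simp only: id_def)
  qed
  have "(\<lambda>\<omega>. \<lambda>k\<in>{..<n}. \<omega> k) \<in> \<Omega> \<rightarrow>\<^sub>M \<G> T"
    unfolding \<G>_def
  proof (rule measurable_restrict)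
    fix k assume k: "k \<in> {..<n}"
    then have "(\<lambda>\<omega>. \<omega> k) \<in> \<Omega> \<rightarrow>\<^sub>M M"
      by (rule measurable_component_singleton)
    from measurable_compose[OF this id] k
    show "(\<lambda>\<omega>. \<omega> k) \<in> \<Omega> \<rightarrow>\<^sub>M natural_filtration M S (X k) T" by simp
  qed
  from measurable_compose[OF this assms(1)]
  have *: "(\<lambda>\<omega>. f (restrict \<omega> {..<n})) \<in> \<Omega> \<rightarrow>\<^sub>M N" .
  have eq: "f (restrict \<omega> {..<n}) = f \<omega>" if "\<omega> \<in> space \<Omega>" for \<omega>
    using that by (simp add: space_PiM PiE_restrict)
  have "(\<lambda>\<omega>. f (restrict \<omega> {..<n})) \<in> \<Omega> \<rightarrow>\<^sub>M N \<longleftrightarrow> f \<in> \<Omega> \<rightarrow>\<^sub>M N"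
    by (rule measurable_cong) (rule eq)
  with * show ?thesis by (simp only:)
qed

lemma Y_in_class: "k < n \<Longrightarrow> \<omega> \<in> space \<Omega> \<Longrightarrow> (\<lambda>t. Y k t \<omega>) \<in> R"
  unfolding Y_def by (rule regular) (auto simp: space_PiM)

lemma Z_in_class: "k < n \<Longrightarrow> \<omega> \<in> space \<Omega> \<Longrightarrow> (\<lambda>t. Z k t \<omega>) \<in> R"
  unfolding Z_def using coalesced_in_class[of k "\<lambda>j s. Y j s \<omega>"] Y_in_class by simp

lemma Y_in_S: "k < n \<Longrightarrow> 0 \<le> t \<Longrightarrow> t \<le> T \<Longrightarrow> \<omega> \<in> space \<Omega> \<Longrightarrow> Y k t \<omega> \<in> S"
  unfolding Y_def using measurable_space[OF X_measurable, of k t "\<omega> k"]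
  by (auto simp: space_PiM space_restrict_space)

lemma Z_in_S: "k < n \<Longrightarrow> 0 \<le> t \<Longrightarrow> t \<le> T \<Longrightarrow> \<omega> \<in> space \<Omega> \<Longrightarrow> Z k t \<omega> \<in> S"
  using coalesced_eq_driving[of k "\<lambda>j s. Y j s \<omega>" t] Y_in_S[of _ t \<omega>]
  by (auto simp: Z_def)

lemma Y_measurable:
  assumes "k < n" "0 \<le> s" "s \<le> t" "t \<le> T"
  shows "Y k s \<in> \<G> t \<rightarrow>\<^sub>M restrict_space borel S"
proof -
  have "(\<lambda>\<omega>. \<omega> k) \<in> \<G> t \<rightarrow>\<^sub>M natural_filtration M S (X k) t"
    unfolding \<G>_def by (rule measurable_component_singleton) (use assms in simp)
  moreover have "X k s \<in> natural_filtration M S (X k) t \<rightarrow>\<^sub>M restrict_space borel S"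
    using X_measurable[of k s] assms by (intro measurable_natural_filtration) auto
  ultimately show ?thesis unfolding Y_def[abs_def] by (rule measurable_compose)
qed

lemma Z_measurable:
  assumes k: "k < n" and s: "0 \<le> s" "s \<le> t" "t \<le> T"
  shows "Z k s \<in> \<G> t \<rightarrow>\<^sub>M restrict_space borel S"
proof -
  have "(\<lambda>\<omega>. approx_coalesced (\<lambda>j u. Y j u \<omega>) k s) \<in> borel_measurable (\<G> t)"
  proof (rule measurable_approx_coalesced[OF _ s(1)])
    fix j u assume "j \<le> k" "0 \<le> u" "u \<le> s"
    then show "Y j u \<in> borel_measurable (\<G> t)"
      using Y_measurable[of j u t] k s by (simp add: measurable_restrict_space2_iff)
  qed
  moreover have eq: "approx_coalesced (\<lambda>j u. Y j u \<omega>) k s = Z k s \<omega>" if "\<omega> \<in> space (\<G> t)" for \<omega>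
    unfolding Z_def using that Y_in_class k s by (intro approx_coalesced_eq) (auto simp: space_\<G>)
  have "(\<lambda>\<omega>. approx_coalesced (\<lambda>j u. Y j u \<omega>) k s) \<in> borel_measurable (\<G> t)
      \<longleftrightarrow> Z k s \<in> borel_measurable (\<G> t)"
    by (rule measurable_cong) (rule eq)
  ultimately have "Z k s \<in> borel_measurable (\<G> t)" by (simp only:)
  then show ?thesis
    using Z_in_S[OF k s(1)] s by (auto simp: measurable_restrict_space2_iff space_\<G>)
qed

lemma sublevel_in_S: "{z \<in> S. z \<le> c} \<in> sets (restrict_space borel S)"
proof -
  have "{z \<in> S. z \<le> c} = S \<inter> {..c}" by auto
  then show ?thesis by (auto simp: sets_restrict_space)
qed

lemma G_bounds:
  assumes "0 \<le> s" "s \<le> T" "p \<in> S"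
  shows "0 \<le> G s p j" "G s p j \<le> 1"
proof -
  have "prob_space (\<kappa> s T p)"
    by (rule transition_function_prob(1)[OF transition]) (use assms in auto)
  then show "0 \<le> G s p j" "G s p j \<le> 1"
    unfolding G_def by (auto intro: prob_space.prob_le_1)
qed

lemma measurable_G:
  assumes "\<tau> \<in> borel_measurable N" "\<And>\<omega>. \<omega> \<in> space N \<Longrightarrow> 0 \<le> \<tau> \<omega> \<and> \<tau> \<omega> \<le> T"
    and "p \<in> N \<rightarrow>\<^sub>M restrict_space borel S"
  shows "(\<lambda>\<omega>. G (\<tau> \<omega>) (p \<omega>) j) \<in> borel_measurable N"
proof -
  have "(\<lambda>(s, x). \<kappa> s T x) \<in> restrict_space borel {0..T} \<Otimes>\<^sub>M restrict_space borel S \<rightarrow>\<^sub>M prob_algebra (restrict_space borel S)"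
    using transition T_pos unfolding transition_function_def by auto
  then have \<kappa>: "(\<lambda>(s, x). \<kappa> s T x) \<in> restrict_space borel {0..T} \<Otimes>\<^sub>M restrict_space borel S \<rightarrow>\<^sub>M subprob_algebra (restrict_space borel S)"
    by (rule measurable_prob_algebraD)
  have "(\<lambda>\<omega>. (\<tau> \<omega>, p \<omega>)) \<in> N \<rightarrow>\<^sub>M restrict_space borel {0..T} \<Otimes>\<^sub>M restrict_space borel S"
    by (intro measurable_Pair measurable_restrict_space2 assms) (use assms in auto)
  from measurable_compose[OF measurable_compose[OF this \<kappa>] measurable_measure_subprob_algebra[OF sublevel_in_S[of "y j"]]]
  show ?thesis unfolding G_def by simp
qed

lemma observed_timeD:
  assumes "observed_time \<sigma>"
  shows "\<omega> \<in> space \<Omega> \<Longrightarrow> 0 \<le> \<sigma> \<omega>" "\<omega> \<in> space \<Omega> \<Longrightarrow> \<sigma> \<omega> \<le> T"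
    "0 \<le> t \<Longrightarrow> t \<le> T \<Longrightarrow> Measurable.pred (\<G> t) (\<lambda>\<omega>. \<sigma> \<omega> \<le> t)"
  using assms by (auto simp: observed_time_def)

text \<open>
  Whether the truncated time is at most \<open>c < t\<close> is decided by time \<open>c\<close>, and for \<open>c \<ge> t\<close> it always is.
\<close>
lemma measurable_min_time:
  assumes "\<And>\<omega>. \<omega> \<in> space \<Omega> \<Longrightarrow> 0 \<le> \<tau> \<omega>"
    and "\<And>s. 0 \<le> s \<Longrightarrow> s \<le> T \<Longrightarrow> Measurable.pred (\<G> s) (\<lambda>\<omega>. \<tau> \<omega> \<le> s)" and "t \<le> T"
  shows "(\<lambda>\<omega>. min (\<tau> \<omega>) t) \<in> borel_measurable (\<G> t)"
proof (rule borel_measurableI_le)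
  fix c
  consider "t \<le> c" | "c < t" "0 \<le> c" | "c < t" "c < 0" by linarith
  then show "{\<omega> \<in> space (\<G> t). min (\<tau> \<omega>) t \<le> c} \<in> sets (\<G> t)"
  proof cases
    case 1
    then have eq: "{\<omega> \<in> space (\<G> t). min (\<tau> \<omega>) t \<le> c} = space (\<G> t)" by (simp add: min_le_iff_disj)
    show ?thesis unfolding eq by (rule sets.top)
  next
    case 2
    then have "Measurable.pred (\<G> t) (\<lambda>\<omega>. \<tau> \<omega> \<le> c)"
      using measurable_\<G>_mono[OF assms(2)[of c], of t] assms(3) by simp
    moreover have eq: "{\<omega> \<in> space (\<G> t). min (\<tau> \<omega>) t \<le> c} = {\<omega> \<in> space (\<G> t). \<tau> \<omega> \<le> c}"
      using 2 by (simp add: min_le_iff_disj)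
    ultimately show ?thesis unfolding eq by (simp only: pred_def)
  next
    case 3
    have "\<not> min (\<tau> \<omega>) t \<le> c" if "\<omega> \<in> space (\<G> t)" for \<omega>
      using assms(1)[of \<omega>] that 3 by (simp add: space_\<G> min_le_iff_disj)
    then have eq: "{\<omega> \<in> space (\<G> t). min (\<tau> \<omega>) t \<le> c} = {}" by blast
    show ?thesis unfolding eq by (rule sets.empty_sets)
  qed
qed

lemma observed_time_const: "0 \<le> c \<Longrightarrow> c \<le> T \<Longrightarrow> observed_time (\<lambda>_. c)"
  by (auto simp: observed_time_def)

lemma measurable_observed_min:
  assumes "observed_time \<sigma>" "t \<le> T"
  shows "(\<lambda>\<omega>. min (\<sigma> \<omega>) t) \<in> borel_measurable (\<G> t)"
  using observed_timeD[OF assms(1)] assms(2) by (intro measurable_min_time) auto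

lemma process_at_observed_time:
  assumes \<sigma>: "observed_time \<sigma>" and t: "0 \<le> t" "t \<le> T"
    and W: "\<And>s. 0 \<le> s \<Longrightarrow> s \<le> t \<Longrightarrow> W s \<in> \<G> t \<rightarrow>\<^sub>M restrict_space borel S"
    and R: "\<And>\<omega>. \<omega> \<in> space \<Omega> \<Longrightarrow> (\<lambda>s. W s \<omega>) \<in> R"
  shows "(\<lambda>\<omega>. W (min (\<sigma> \<omega>) t) \<omega>) \<in> \<G> t \<rightarrow>\<^sub>M restrict_space borel S"
proof -
  have "(\<lambda>\<omega>. W (min (\<sigma> \<omega>) t) \<omega>) \<in> borel_measurable (\<G> t)"
  proof (rule measurable_at_random_time[of t W _ "\<lambda>\<omega>. min (\<sigma> \<omega>) t"])
    show "W s \<in> borel_measurable (\<G> t)" if "0 \<le> s" "s \<le> t" for s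
      using W[OF that] by (simp add: measurable_restrict_space2_iff)
    show "(\<lambda>\<omega>. min (\<sigma> \<omega>) t) \<in> borel_measurable (\<G> t)" by (rule measurable_observed_min[OF \<sigma> t(2)])
    show "0 \<le> min (\<sigma> \<omega>) t \<and> min (\<sigma> \<omega>) t \<le> t" if "\<omega> \<in> space (\<G> t)" for \<omega>
    proof -
      have "0 \<le> \<sigma> \<omega>" using observed_timeD(1)[OF \<sigma>] that unfolding space_\<G> .
      then show ?thesis using t by simp
    qed
    show "((\<lambda>u. W u \<omega>) \<longlongrightarrow> W s \<omega>) (at_right s)" if "\<omega> \<in> space (\<G> t)" "0 \<le> s" "s < t" for \<omega> s
      using right_cont[OF R, of \<omega> s] that t by (simp add: space_\<G>)
  qed (rule t)
  moreover have "W (min (\<sigma> \<omega>) t) \<omega> \<in> S" if "\<omega> \<in> space (\<G> t)" for \<omega>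
    using measurable_space[OF W that] observed_timeD(1)[OF \<sigma>] that t
    by (simp add: space_\<G> space_restrict_space)
  ultimately show ?thesis by (auto simp: measurable_restrict_space2_iff)
qed

lemma known_at_const: "observed_time \<sigma> \<Longrightarrow> known_at \<sigma> (\<lambda>_. c)"
  unfolding known_at_def
proof (intro conjI exI ballI)
  fix t assume \<sigma>: "observed_time \<sigma>" and t: "t \<in> {0..T}"
  have [measurable]: "Measurable.pred (\<G> t) (\<lambda>\<omega>. \<sigma> \<omega> \<le> t)"
    using observed_timeD(3)[OF \<sigma>, of t] t by simp
  show "(\<lambda>\<omega>. of_bool (\<sigma> \<omega> \<le> t) * c) \<in> borel_measurable (\<G> t)" by measurable
qed (rule order_refl)

lemma known_atD:
  "known_at \<sigma> f \<Longrightarrow> 0 \<le> t \<Longrightarrow> t \<le> T \<Longrightarrow> (\<lambda>\<omega>. of_bool (\<sigma> \<omega> \<le> t) * f \<omega>) \<in> borel_measurable (\<G> t)"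
  unfolding known_at_def by simp

lemma known_at_mult:
  assumes "known_at \<sigma> f" "known_at \<sigma> g"
  shows "known_at \<sigma> (\<lambda>\<omega>. f \<omega> * g \<omega>)"
proof -
  obtain C D where *: "\<And>\<omega>. \<omega>\<in>space \<Omega> \<Longrightarrow> \<bar>f \<omega>\<bar> \<le> C" "\<And>\<omega>. \<omega>\<in>space \<Omega> \<Longrightarrow> \<bar>g \<omega>\<bar> \<le> D"
    using assms unfolding known_at_def by blast
  have bd: "\<bar>f \<omega> * g \<omega>\<bar> \<le> C * D" if "\<omega> \<in> space \<Omega>" for \<omega>
    unfolding abs_mult using *(1)[OF that] *(2)[OF that] by (intro mult_mono) auto
  have "(\<lambda>\<omega>. of_bool (\<sigma> \<omega> \<le> t) * (f \<omega> * g \<omega>)) \<in> borel_measurable (\<G> t)" if "t \<in> {0..T}" for t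
  proof -
    have "(\<lambda>\<omega>. (of_bool (\<sigma> \<omega> \<le> t) * f \<omega>) * (of_bool (\<sigma> \<omega> \<le> t) * g \<omega>)) \<in> borel_measurable (\<G> t)"
      using that by (intro borel_measurable_times[OF known_atD[OF assms(1)] known_atD[OF assms(2)]]) simp_all
    moreover have "(\<lambda>\<omega>. (of_bool (\<sigma> \<omega> \<le> t) * f \<omega>) * (of_bool (\<sigma> \<omega> \<le> t) * g \<omega>))
        = (\<lambda>\<omega>. of_bool (\<sigma> \<omega> \<le> t) * (f \<omega> * g \<omega>))" by (auto simp: fun_eq_iff of_bool_def)
    ultimately show ?thesis by simp
  qed
  with bd show ?thesis unfolding known_at_def by blast
qed

lemma known_at_diff:
  assumes "known_at \<sigma> f" "known_at \<sigma> g"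
  shows "known_at \<sigma> (\<lambda>\<omega>. f \<omega> - g \<omega>)"
proof -
  obtain C D where *: "\<And>\<omega>. \<omega>\<in>space \<Omega> \<Longrightarrow> \<bar>f \<omega>\<bar> \<le> C" "\<And>\<omega>. \<omega>\<in>space \<Omega> \<Longrightarrow> \<bar>g \<omega>\<bar> \<le> D"
    using assms unfolding known_at_def by blast
  have bd: "\<bar>f \<omega> - g \<omega>\<bar> \<le> C + D" if "\<omega> \<in> space \<Omega>" for \<omega>
    using *(1)[OF that] *(2)[OF that] by linarith
  have "(\<lambda>\<omega>. of_bool (\<sigma> \<omega> \<le> t) * (f \<omega> - g \<omega>)) \<in> borel_measurable (\<G> t)" if "t \<in> {0..T}" for t
    unfolding right_diff_distrib using that
    by (intro borel_measurable_diff[OF known_atD[OF assms(1)] known_atD[OF assms(2)]]) simp_all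
  with bd show ?thesis unfolding known_at_def by blast
qed

lemma known_at_bounded_measurable:
  assumes "observed_time \<sigma>" "known_at \<sigma> f"
  shows "bounded_measurable \<Omega> f"
proof -
  have "(\<lambda>\<omega>. of_bool (\<sigma> \<omega> \<le> T) * f \<omega>) \<in> borel_measurable (\<G> T)"
    using assms T_pos by (simp add: known_at_def)
  then have "(\<lambda>\<omega>. of_bool (\<sigma> \<omega> \<le> T) * f \<omega>) \<in> borel_measurable \<Omega>" by (rule measurable_\<G>_T)
  moreover have "(\<lambda>\<omega>. of_bool (\<sigma> \<omega> \<le> T) * f \<omega>) \<in> borel_measurable \<Omega> \<longleftrightarrow> f \<in> borel_measurable \<Omega>"
    by (rule measurable_cong) (simp add: observed_timeD(2)[OF assms(1)])
  ultimately have "f \<in> borel_measurable \<Omega>" by (simp only:)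
  then show ?thesis using assms(2) unfolding known_at_def bounded_measurable_def by blast
qed

lemma known_at_G:
  assumes \<sigma>: "observed_time \<sigma>"
    and W: "\<And>s t. 0 \<le> s \<Longrightarrow> s \<le> t \<Longrightarrow> t \<le> T \<Longrightarrow> W s \<in> \<G> t \<rightarrow>\<^sub>M restrict_space borel S"
    and R: "\<And>\<omega>. \<omega> \<in> space \<Omega> \<Longrightarrow> (\<lambda>s. W s \<omega>) \<in> R"
  shows "known_at \<sigma> (\<lambda>\<omega>. G (\<sigma> \<omega>) (W (\<sigma> \<omega>) \<omega>) j)"
  unfolding known_at_def
proof (intro conjI exI ballI)
  fix \<omega> assume \<omega>: "\<omega> \<in> space \<Omega>"
  have \<sigma>\<omega>: "0 \<le> \<sigma> \<omega>" "\<sigma> \<omega> \<le> T" using observed_timeD(1,2)[OF \<sigma> \<omega>] .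
  have "W (\<sigma> \<omega>) \<omega> \<in> space (restrict_space borel S)"
    by (rule measurable_space[OF W[OF \<sigma>\<omega> order_refl]]) (simp only: space_\<G> \<omega>)
  then have WS: "W (\<sigma> \<omega>) \<omega> \<in> S" by (simp add: space_restrict_space)
  show "\<bar>G (\<sigma> \<omega>) (W (\<sigma> \<omega>) \<omega>) j\<bar> \<le> 1"
    using G_bounds[OF \<sigma>\<omega> WS] by (simp only: abs_of_nonneg)
next
  fix t assume t: "t \<in> {0..T}"
  have tT: "0 \<le> t" "t \<le> T" using t by simp_all
  have range: "0 \<le> min (\<sigma> \<omega>) t \<and> min (\<sigma> \<omega>) t \<le> T" if "\<omega> \<in> space (\<G> t)" for \<omega>
  proof -
    have "0 \<le> \<sigma> \<omega>" using observed_timeD(1)[OF \<sigma>] that unfolding space_\<G> .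
    then show ?thesis using tT by (simp add: min_le_iff_disj)
  qed
  have W': "(\<lambda>\<omega>. W (min (\<sigma> \<omega>) t) \<omega>) \<in> \<G> t \<rightarrow>\<^sub>M restrict_space borel S"
    by (rule process_at_observed_time[OF \<sigma> tT W[OF _ _ tT(2)] R])
  have "(\<lambda>\<omega>. G (min (\<sigma> \<omega>) t) (W (min (\<sigma> \<omega>) t) \<omega>) j) \<in> borel_measurable (\<G> t)"
    by (rule measurable_G[OF measurable_observed_min[OF \<sigma> tT(2)] _ W']) (rule range)
  moreover have "(\<lambda>\<omega>. of_bool (\<sigma> \<omega> \<le> t)) \<in> borel_measurable (\<G> t)"
  proof -
    have [measurable]: "Measurable.pred (\<G> t) (\<lambda>\<omega>. \<sigma> \<omega> \<le> t)"
      using observed_timeD(3)[OF \<sigma>, of t] t by simp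
    show ?thesis by measurable
  qed
  ultimately have "(\<lambda>\<omega>. of_bool (\<sigma> \<omega> \<le> t) * G (min (\<sigma> \<omega>) t) (W (min (\<sigma> \<omega>) t) \<omega>) j) \<in> borel_measurable (\<G> t)"
    by (intro borel_measurable_times)
  moreover have "of_bool (\<sigma> \<omega> \<le> t) * G (min (\<sigma> \<omega>) t) (W (min (\<sigma> \<omega>) t) \<omega>) j
      = of_bool (\<sigma> \<omega> \<le> t) * G (\<sigma> \<omega>) (W (\<sigma> \<omega>) \<omega>) j" for \<omega>
    by (cases "\<sigma> \<omega> \<le> t") (auto simp: min_absorb1)
  ultimately show "(\<lambda>\<omega>. of_bool (\<sigma> \<omega> \<le> t) * G (\<sigma> \<omega>) (W (\<sigma> \<omega>) \<omega>) j) \<in> borel_measurable (\<G> t)"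
    by simp
qed

lemma known_at_GZ: "k < n \<Longrightarrow> observed_time \<sigma> \<Longrightarrow> known_at \<sigma> (\<lambda>\<omega>. G (\<sigma> \<omega>) (Z k (\<sigma> \<omega>) \<omega>) j)"
  by (rule known_at_G[OF _ Z_measurable Z_in_class])

lemma known_at_GY: "k < n \<Longrightarrow> observed_time \<sigma> \<Longrightarrow> known_at \<sigma> (\<lambda>\<omega>. G (\<sigma> \<omega>) (Y k (\<sigma> \<omega>) \<omega>) j)"
  by (rule known_at_G[OF _ Y_measurable Y_in_class])

lemma measurable_end_value:
  assumes "W \<in> \<G> T \<rightarrow>\<^sub>M restrict_space borel S"
  shows "bounded_measurable \<Omega> (\<lambda>\<omega>. of_bool (W \<omega> \<le> c))"
proof -
  have [measurable]: "W \<in> borel_measurable \<Omega>"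
    using measurable_\<G>_T[OF assms] by (simp add: measurable_restrict_space2_iff)
  then show ?thesis by (intro bounded_measurable_of_bool) measurable
qed

lemma bounded_measurable_G:
  assumes \<sigma>: "observed_time \<sigma>" and k: "k < n"
  shows "bounded_measurable \<Omega> (\<lambda>\<omega>. G (\<sigma> \<omega>) (Y k (\<sigma> \<omega>) \<omega>) j)"
  by (rule known_at_bounded_measurable[OF \<sigma> known_at_G[OF \<sigma> Y_measurable[OF k] Y_in_class[OF k]]])

section \<open>Freezing all particles but one\<close>

lemma section_in_\<Omega>:
  "k < n \<Longrightarrow> \<omega> \<in> space (Pi\<^sub>M ({..<n} - {k}) (\<lambda>_. M)) \<Longrightarrow> a \<in> space M \<Longrightarrow> \<omega> (k := a) \<in> space \<Omega>"
  by (auto simp: space_PiM PiE_iff extensional_def)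

lemma measurable_section:
  assumes k: "k < n" and \<omega>: "\<omega> \<in> space (Pi\<^sub>M ({..<n} - {k}) (\<lambda>_. M))"
  shows "(\<lambda>a. \<omega> (k := a)) \<in> natural_filtration M S (X k) t \<rightarrow>\<^sub>M \<G> t"
  unfolding \<G>_def
proof (rule measurable_fun_upd[where J = "{..<n} - {k}"])
  show "{..<n} = {..<n} - {k} \<union> {k}" using k by auto
  show "(\<lambda>a. \<omega>) \<in> natural_filtration M S (X k) t
      \<rightarrow>\<^sub>M Pi\<^sub>M ({..<n} - {k}) (\<lambda>k. natural_filtration M S (X k) t)"
    by (rule measurable_const) (use \<omega> in \<open>simp only: space_PiM space_natural_filtration\<close>)
  show "(\<lambda>a. a) \<in> natural_filtration M S (X k) t \<rightarrow>\<^sub>M natural_filtration M S (X k) t"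
    by (rule measurable_ident_sets) (rule refl)
qed

lemma stopping_time_section:
  assumes \<sigma>: "observed_time \<sigma>" and k: "k < n" and \<omega>: "\<omega> \<in> space (Pi\<^sub>M ({..<n} - {k}) (\<lambda>_. M))"
  shows "stopping_time (natural_filtration M S (X k)) (\<lambda>a. \<sigma> (\<omega> (k := a)))"
proof
  fix t
  have r: "0 \<le> \<sigma> (\<omega> (k := a))" "\<sigma> (\<omega> (k := a)) \<le> T" if "a \<in> space M" for a
    using observed_timeD(1,2)[OF \<sigma> section_in_\<Omega>[OF k \<omega> that]] .
  consider "t < 0" | "0 \<le> t" "t \<le> T" | "T < t" by linarith
  then show "Measurable.pred (natural_filtration M S (X k) t) (\<lambda>a. \<sigma> (\<omega> (k := a)) \<le> t)"
  proof cases
    case 1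
    then have eq: "{a \<in> space M. \<sigma> (\<omega> (k := a)) \<le> t} = {}" using r(1) by fastforce
    show ?thesis unfolding pred_def space_natural_filtration eq by (rule sets.empty_sets)
  next
    case 2
    from measurable_compose[OF measurable_section[OF k \<omega>] observed_timeD(3)[OF \<sigma> 2]] show ?thesis .
  next
    case 3
    then have eq: "{a \<in> space M. \<sigma> (\<omega> (k := a)) \<le> t} = space (natural_filtration M S (X k) t)"
      using r(2) by (fastforce simp: space_natural_filtration)
    show ?thesis unfolding pred_def unfolding space_natural_filtration unfolding eq by (rule sets.top)
  qed
qed

text \<open>
  The weights allowed in the strong Markov property of particle \<open>k\<close>: with the other coordinates frozen,
  they depend on the path of particle \<open>k\<close> up to time \<open>\<sigma>\<close> only. This covers both quantities known at
  \<open>\<sigma>\<close> and quantities that look into the future of the other particles.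
\<close>
definition section_known :: "nat \<Rightarrow> ((nat \<Rightarrow> 'w) \<Rightarrow> real) \<Rightarrow> ((nat \<Rightarrow> 'w) \<Rightarrow> real) \<Rightarrow> bool" where
  "section_known k \<sigma> f \<longleftrightarrow> bounded_measurable \<Omega> f \<and>
     (\<forall>\<omega>\<in>space (Pi\<^sub>M ({..<n} - {k}) (\<lambda>_. M)).
        (\<lambda>a. f (\<omega> (k := a))) \<in> borel_measurable
          (filtration.pre_sigma (space M) (natural_filtration M S (X k)) (\<lambda>a. \<sigma> (\<omega> (k := a)))))"

text \<open>
  Sections of quantities in the joint past at \<open>t\<close> are in the past of particle \<open>k\<close> at \<open>t\<close>. Times outside
  \<open>{0..T}\<close> are reduced to this range because \<open>\<sigma>\<close> takes no values there.
\<close>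
lemma known_at_section_known:
  assumes \<sigma>: "observed_time \<sigma>" and f: "known_at \<sigma> f" and k: "k < n"
  shows "section_known k \<sigma> f"
  unfolding section_known_def
proof (intro conjI ballI)
  show "bounded_measurable \<Omega> f" by (rule known_at_bounded_measurable[OF \<sigma> f])
  fix \<omega> assume \<omega>: "\<omega> \<in> space (Pi\<^sub>M ({..<n} - {k}) (\<lambda>_. M))"
  interpret F: filtration "space M" "natural_filtration M S (X k)" by (rule filtration_natural)
  let ?\<tau> = "\<lambda>a. \<sigma> (\<omega> (k := a))" and ?f = "\<lambda>a. f (\<omega> (k := a))"
  note st = stopping_time_section[OF \<sigma> k \<omega>]
  have r: "0 \<le> ?\<tau> a" "?\<tau> a \<le> T" if "a \<in> space M" for a
    using observed_timeD(1,2)[OF \<sigma> section_in_\<Omega>[OF k \<omega> that]] .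
  have mid: "{a \<in> space M. ?f a \<le> c \<and> ?\<tau> a \<le> t} \<in> sets (natural_filtration M S (X k) t)"
    if t: "0 \<le> t" "t \<le> T" for c t
  proof -
    have [measurable]: "(\<lambda>a. of_bool (?\<tau> a \<le> t) * ?f a) \<in> borel_measurable (natural_filtration M S (X k) t)"
      using measurable_compose[OF measurable_section[OF k \<omega>] known_atD[OF f t]] .
    have [measurable]: "Measurable.pred (natural_filtration M S (X k) t) (\<lambda>a. ?\<tau> a \<le> t)"
      using stopping_timeD[OF st] .
    have "{a \<in> space (natural_filtration M S (X k) t). of_bool (?\<tau> a \<le> t) * ?f a \<le> c \<and> ?\<tau> a \<le> t}
        \<in> sets (natural_filtration M S (X k) t)" by measurable
    moreover have "{a \<in> space (natural_filtration M S (X k) t). of_bool (?\<tau> a \<le> t) * ?f a \<le> c \<and> ?\<tau> a \<le> t}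
        = {a \<in> space M. ?f a \<le> c \<and> ?\<tau> a \<le> t}"
      unfolding space_natural_filtration by (intro Collect_cong) auto
    ultimately show ?thesis by (simp only:)
  qed
  show "?f \<in> borel_measurable (F.pre_sigma ?\<tau>)"
  proof (rule borel_measurableI_le, rule F.sets_pre_sigmaI[OF st])
    fix c t
    have eq: "{a \<in> {a \<in> space (F.pre_sigma ?\<tau>). ?f a \<le> c}. ?\<tau> a \<le> t} = {a \<in> space M. ?f a \<le> c \<and> ?\<tau> a \<le> t}"
      unfolding F.space_pre_sigma by blast
    consider "t < 0" | "0 \<le> t" "t \<le> T" | "T < t" by linarith
    then show "{a \<in> {a \<in> space (F.pre_sigma ?\<tau>). ?f a \<le> c}. ?\<tau> a \<le> t} \<in> sets (natural_filtration M S (X k) t)"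
      unfolding eq
    proof cases
      case 1
      then have eq: "{a \<in> space M. ?f a \<le> c \<and> ?\<tau> a \<le> t} = {}" using r(1) by fastforce
      show "{a \<in> space M. ?f a \<le> c \<and> ?\<tau> a \<le> t} \<in> sets (natural_filtration M S (X k) t)"
        unfolding eq by (rule sets.empty_sets)
    next
      case 2
      then show "{a \<in> space M. ?f a \<le> c \<and> ?\<tau> a \<le> t} \<in> sets (natural_filtration M S (X k) t)" by (rule mid)
    next
      case 3
      have "{a \<in> space M. ?f a \<le> c \<and> ?\<tau> a \<le> t} = {a \<in> space M. ?f a \<le> c \<and> ?\<tau> a \<le> T}"
        using r(2) 3 by fastforce
      also have "\<dots> \<in> sets (natural_filtration M S (X k) T)" using T_pos by (intro mid) simp_all
      also have "\<dots> \<subseteq> sets (natural_filtration M S (X k) t)" using 3 by (intro F.sets_F_mono) simp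
      finally show "{a \<in> space M. ?f a \<le> c \<and> ?\<tau> a \<le> t} \<in> sets (natural_filtration M S (X k) t)" .
    qed
  qed
qed

lemma section_known_free:
  assumes "bounded_measurable \<Omega> f" and free: "\<And>\<omega> a. f (\<omega> (k := a)) = f \<omega>"
  shows "section_known k \<sigma> f"
  unfolding section_known_def
proof (intro conjI ballI)
  fix \<omega> :: "nat \<Rightarrow> 'w"
  show "(\<lambda>a. f (\<omega> (k := a))) \<in> borel_measurable
      (filtration.pre_sigma (space M) (natural_filtration M S (X k)) (\<lambda>a. \<sigma> (\<omega> (k := a))))"
    unfolding free by (rule borel_measurable_const)
qed (rule assms)

lemma section_known_mult:
  "section_known k \<sigma> f \<Longrightarrow> section_known k \<sigma> g \<Longrightarrow> section_known k \<sigma> (\<lambda>\<omega>. f \<omega> * g \<omega>)"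
  unfolding section_known_def
  by (intro conjI ballI bounded_measurable_mult borel_measurable_times) blast+

lemma section_known_rows_det:
  assumes "\<And>i j. i < n \<Longrightarrow> j < n \<Longrightarrow> section_known k \<sigma> (\<lambda>\<omega>. r \<omega> i j)"
  shows "section_known k \<sigma> (\<lambda>\<omega>. rows_det n (r \<omega>))"
  unfolding section_known_def
proof (intro conjI ballI)
  show "bounded_measurable \<Omega> (\<lambda>\<omega>. rows_det n (r \<omega>))"
    using assms unfolding section_known_def by (intro bounded_measurable_rows_det) blast
  fix \<omega> assume \<omega>: "\<omega> \<in> space (Pi\<^sub>M ({..<n} - {k}) (\<lambda>_. M))"
  let ?F = "filtration.pre_sigma (space M) (natural_filtration M S (X k)) (\<lambda>a. \<sigma> (\<omega> (k := a)))"
  have "(\<lambda>a. r (\<omega> (k := a)) i (p i)) \<in> borel_measurable ?F" if "i \<in> {0..<n}" "p permutes {0..<n}" for i p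
  proof -
    have "i < n" "p i < n" using that permutes_in_image[OF that(2), of i] by simp_all
    from assms[OF this] \<omega> show ?thesis unfolding section_known_def by blast
  qed
  then show "(\<lambda>a. rows_det n (r (\<omega> (k := a)))) \<in> borel_measurable ?F"
    unfolding rows_det_perm
    by (intro borel_measurable_sum borel_measurable_times borel_measurable_const borel_measurable_prod) blast
qed

text \<open>
  Fubini's theorem reduces this to a fixed configuration of the other coordinates, where \<open>\<sigma>\<close> is a
  stopping time of particle \<open>k\<close> alone.
\<close>
lemma strong_markov_frozen:
  assumes k: "k < n" and \<sigma>: "observed_time \<sigma>" and f: "section_known k \<sigma> f"
  shows "(\<integral>\<omega>. f \<omega> * of_bool (Y k T \<omega> \<le> y j) \<partial>\<Omega>) = (\<integral>\<omega>. f \<omega> * G (\<sigma> \<omega>) (Y k (\<sigma> \<omega>) \<omega>) j \<partial>\<Omega>)"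
proof -
  interpret PS: product_sigma_finite "\<lambda>_. M" ..
  interpret P: prob_space \<Omega> by (rule prob_space_\<Omega>)
  have I: "insert k ({..<n} - {k}) = {..<n}" using k by auto
  have fb: "bounded_measurable \<Omega> f" using f unfolding section_known_def by blast
  have YT: "bounded_measurable \<Omega> (\<lambda>\<omega>. of_bool (Y k T \<omega> \<le> y j))"
    by (rule measurable_end_value[OF Y_measurable[OF k]]) (use T_pos in auto)
  have Gb: "bounded_measurable \<Omega> (\<lambda>\<omega>. G (\<sigma> \<omega>) (Y k (\<sigma> \<omega>) \<omega>) j)" by (rule bounded_measurable_G[OF \<sigma> k])
  have fubini: "(\<integral>\<omega>. h \<omega> \<partial>\<Omega>) = (\<integral>\<omega>. (\<integral>a. h (\<omega> (k := a)) \<partial>M) \<partial>(Pi\<^sub>M ({..<n} - {k}) (\<lambda>_. M)))"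
    if "bounded_measurable \<Omega> h" for h :: "(nat \<Rightarrow> 'w) \<Rightarrow> real"
  proof -
    have "integrable (Pi\<^sub>M (insert k ({..<n} - {k})) (\<lambda>_. M)) h"
      unfolding I by (rule P.integrable_bounded_measurable[OF that])
    from PS.product_integral_insert[OF _ _ this] show ?thesis unfolding I by simp
  qed
  have "(\<integral>a. f (\<omega> (k := a)) * of_bool (Y k T (\<omega> (k := a)) \<le> y j) \<partial>M)
      = (\<integral>a. f (\<omega> (k := a)) * G (\<sigma> (\<omega> (k := a))) (Y k (\<sigma> (\<omega> (k := a))) (\<omega> (k := a))) j \<partial>M)"
    if \<omega>: "\<omega> \<in> space (Pi\<^sub>M ({..<n} - {k}) (\<lambda>_. M))" for \<omega>
  proof -
    let ?\<tau> = "\<lambda>a. \<sigma> (\<omega> (k := a))" and ?f = "\<lambda>a. f (\<omega> (k := a))"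
    let ?B = "{z \<in> S. z \<le> y j}"
    interpret F: filtration "space M" "natural_filtration M S (X k)" by (rule filtration_natural)
    note st = stopping_time_section[OF \<sigma> k \<omega>]
    have r: "0 \<le> ?\<tau> a \<and> ?\<tau> a \<le> T" if "a \<in> space M" for a
      using observed_timeD(1,2)[OF \<sigma> section_in_\<Omega>[OF k \<omega> that]] by (rule conjI)
    have "(\<lambda>a. a) \<in> M \<rightarrow>\<^sub>M natural_filtration M S (X k) T"
    proof -
      have "subalgebra M (natural_filtration M S (X k) T)"
        unfolding subalgebra_def space_natural_filtration
        using natural_filtration_subset[OF X_measurable[OF k]] by (intro conjI refl)
      from measurable_from_subalg[OF this measurable_ident] show ?thesis by (simp only: id_def)
    qed
    from measurable_compose[OF this measurable_section[OF k \<omega>]]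
    have sec: "(\<lambda>a. \<omega> (k := a)) \<in> M \<rightarrow>\<^sub>M \<G> T" .
    have T0: "0 \<le> T" using T_pos by simp
    have sub: "bounded_measurable (F.pre_sigma ?\<tau>) ?f"
    proof -
      obtain C where C: "\<And>\<omega>. \<omega> \<in> space \<Omega> \<Longrightarrow> \<bar>f \<omega>\<bar> \<le> C" using fb unfolding bounded_measurable_def by blast
      show ?thesis
      proof (rule bounded_measurableI[of _ _ C])
        show "?f \<in> borel_measurable (F.pre_sigma ?\<tau>)" using f \<omega> unfolding section_known_def by blast
        show "\<bar>?f a\<bar> \<le> C" if "a \<in> space (F.pre_sigma ?\<tau>)" for a
          using that unfolding F.space_pre_sigma by (intro C section_in_\<Omega>[OF k \<omega>])
      qed
    qed
    have "(\<lambda>a. of_bool (?\<tau> a \<le> T) * G (?\<tau> a) (Y k (?\<tau> a) (\<omega> (k := a))) j) \<in> borel_measurable M"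
      using measurable_compose[OF sec known_atD[OF known_at_G[OF \<sigma> Y_measurable[OF k] Y_in_class[OF k]] T0 order_refl]] .
    moreover have "(\<lambda>a. of_bool (?\<tau> a \<le> T) * G (?\<tau> a) (Y k (?\<tau> a) (\<omega> (k := a))) j) \<in> borel_measurable M
        \<longleftrightarrow> (\<lambda>a. measure (\<kappa> (?\<tau> a) T (X k (?\<tau> a) a)) ?B) \<in> borel_measurable M"
      by (rule measurable_cong) (simp add: r G_def Y_def)
    ultimately have mG: "(\<lambda>a. measure (\<kappa> (?\<tau> a) T (X k (?\<tau> a) a)) ?B) \<in> borel_measurable M" by (simp only:)
    have "(\<integral>a. ?f a * of_bool (Y k T (\<omega> (k := a)) \<le> y j) \<partial>M)
        = (\<integral>a. ?f a * indicator (X k T -` ?B \<inter> space M) a \<partial>M)"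
    proof (rule Bochner_Integration.integral_cong[OF refl])
      fix a assume a: "a \<in> space M"
      have "X k T a \<in> S"
        using measurable_space[OF X_measurable[OF k T0 order_refl] a] by (simp add: space_restrict_space)
      then show "?f a * of_bool (Y k T (\<omega> (k := a)) \<le> y j) = ?f a * indicator (X k T -` ?B \<inter> space M) a"
        using a by (simp add: Y_def indicator_def)
    qed
    also have "\<dots> = (\<integral>a. ?f a * measure (\<kappa> (?\<tau> a) T (X k (?\<tau> a) a)) ?B \<partial>M)"
      by (rule strong_markov_integral[OF markov[OF k] T0 st r sub sublevel_in_S mG])
    finally show ?thesis by (simp add: G_def Y_def)
  qed
  then show ?thesis
    unfolding fubini[OF bounded_measurable_mult[OF fb YT]] fubini[OF bounded_measurable_mult[OF fb Gb]]
    by (rule Bochner_Integration.integral_cong[OF refl])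
qed

text \<open>
  Expand the determinant along row \<open>k\<close>; the cofactors are admissible weights in
  \<open>strong_markov_frozen\<close>.
\<close>
lemma free_row_expectation_zero:
  assumes k: "k < n" and \<sigma>: "observed_time \<sigma>" and \<theta>: "section_known k \<sigma> \<theta>"
    and r: "\<And>i j. i < n \<Longrightarrow> j < n \<Longrightarrow> i \<noteq> k \<Longrightarrow> section_known k \<sigma> (\<lambda>\<omega>. r \<omega> i j)"
  shows "(\<integral>\<omega>. \<theta> \<omega> * rows_det n ((r \<omega>)(k := \<lambda>j. of_bool (Y k T \<omega> \<le> y j) - G (\<sigma> \<omega>) (Y k (\<sigma> \<omega>) \<omega>) j)) \<partial>\<Omega>) = 0"
proof -
  interpret P: prob_space \<Omega> by (rule prob_space_\<Omega>)
  let ?a = "\<lambda>\<omega> j. of_bool (Y k T \<omega> \<le> y j) :: real" and ?G = "\<lambda>\<omega> j. G (\<sigma> \<omega>) (Y k (\<sigma> \<omega>) \<omega>) j"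
  define D where "D l \<omega> = \<theta> \<omega> * rows_det n ((r \<omega>)(k := (\<lambda>j. of_bool (j = l))))" for l \<omega>
  have D: "section_known k \<sigma> (D l)" for l
    unfolding D_def[abs_def]
  proof (intro section_known_mult[OF \<theta>] section_known_rows_det)
    fix i j assume ij: "i < n" "j < n"
    show "section_known k \<sigma> (\<lambda>\<omega>. ((r \<omega>)(k := (\<lambda>j. of_bool (j = l)))) i j)"
    proof (cases "i = k")
      case True
      then show ?thesis by (auto intro!: section_known_free bounded_measurable_const)
    next
      case False
      then show ?thesis using r[OF ij False] by simp
    qed
  qed
  have Db: "bounded_measurable \<Omega> (D l)" for l using D[of l] unfolding section_known_def by blast
  have YT: "bounded_measurable \<Omega> (\<lambda>\<omega>. ?a \<omega> j)" for j
    by (rule measurable_end_value[OF Y_measurable[OF k]]) (use T_pos in auto)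
  have Gb: "bounded_measurable \<Omega> (\<lambda>\<omega>. ?G \<omega> j)" for j by (rule bounded_measurable_G[OF \<sigma> k])
  have "\<theta> \<omega> * rows_det n ((r \<omega>)(k := \<lambda>j. ?a \<omega> j - ?G \<omega> j)) = (\<Sum>l<n. D l \<omega> * ?a \<omega> l - D l \<omega> * ?G \<omega> l)" for \<omega>
    unfolding rows_det_expand[OF k, of "r \<omega>" "\<lambda>j. ?a \<omega> j - ?G \<omega> j"] D_def
    by (simp add: sum_distrib_left algebra_simps)
  then have "(\<integral>\<omega>. \<theta> \<omega> * rows_det n ((r \<omega>)(k := \<lambda>j. ?a \<omega> j - ?G \<omega> j)) \<partial>\<Omega>)
      = (\<integral>\<omega>. (\<Sum>l<n. D l \<omega> * ?a \<omega> l - D l \<omega> * ?G \<omega> l) \<partial>\<Omega>)" by (simp only:)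
  also have "\<dots> = (\<Sum>l<n. \<integral>\<omega>. D l \<omega> * ?a \<omega> l - D l \<omega> * ?G \<omega> l \<partial>\<Omega>)"
    by (intro Bochner_Integration.integral_sum P.integrable_bounded_measurable
        bounded_measurable_diff bounded_measurable_mult Db YT Gb)
  also have "\<dots> = (\<Sum>l<n. (\<integral>\<omega>. D l \<omega> * ?a \<omega> l \<partial>\<Omega>) - (\<integral>\<omega>. D l \<omega> * ?G \<omega> l \<partial>\<Omega>))"
    by (intro sum.cong refl Bochner_Integration.integral_diff P.integrable_bounded_measurable
        bounded_measurable_mult Db YT Gb)
  also have "\<dots> = 0"
    by (intro sum.neutral ballI) (simp only: strong_markov_frozen[OF k \<sigma> D] diff_self)
  finally show ?thesis .
qed

section \<open>Meeting times\<close>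

definition meeting_time :: "nat \<Rightarrow> (nat \<Rightarrow> 'w) \<Rightarrow> real" where
  "meeting_time k \<omega> = first_meeting T (\<lambda>t. Y (Suc k) t \<omega>) (\<lambda>t. Z k t \<omega>)"

lemma meeting_time_nonneg: "Suc k < n \<Longrightarrow> \<omega> \<in> space \<Omega> \<Longrightarrow> 0 \<le> meeting_time k \<omega>"
  unfolding meeting_time_def by (intro first_meeting_nonneg Y_in_class Z_in_class) auto

lemma Z_Suc:
  "Suc k < n \<Longrightarrow> \<omega> \<in> space \<Omega> \<Longrightarrow> t \<le> T \<Longrightarrow>
    Z (Suc k) t \<omega> = (if meeting_time k \<omega> \<le> t then Z k t \<omega> else Y (Suc k) t \<omega>)"
  using coalesced_Suc_first_meeting[of "\<lambda>j s. Y j s \<omega>" k t] Y_in_class[of "Suc k" \<omega>] Z_in_class[of k \<omega>]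
  by (simp add: meeting_time_def Z_def)

lemma meeting_time_meets:
  "Suc k < n \<Longrightarrow> \<omega> \<in> space \<Omega> \<Longrightarrow> meeting_time k \<omega> \<le> T \<Longrightarrow>
    Y (Suc k) (meeting_time k \<omega>) \<omega> = Z k (meeting_time k \<omega>) \<omega>"
  using first_meeting_meets[OF Y_in_class[of "Suc k" \<omega>] Z_in_class[of k \<omega>]]
  by (simp add: meeting_time_def)

lemma meeting_time_measurable:
  assumes k: "Suc k < n" and t: "0 \<le> t" "t \<le> T"
  shows "Measurable.pred (\<G> t) (\<lambda>\<omega>. meeting_time k \<omega> \<le> t)"
proof -
  have "Measurable.pred (\<G> t) (\<lambda>\<omega>. nearly_meet t (\<lambda>s. Y (Suc k) s \<omega>) (\<lambda>s. Z k s \<omega>))"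
  proof (rule measurable_nearly_meet[OF _ _ t(1)])
    fix s assume s: "0 \<le> s" "s \<le> t"
    show "Y (Suc k) s \<in> borel_measurable (\<G> t)"
      using Y_measurable[OF k s t(2)] by (simp add: measurable_restrict_space2_iff)
    show "Z k s \<in> borel_measurable (\<G> t)"
      using Z_measurable[OF Suc_lessD[OF k] s t(2)] by (simp add: measurable_restrict_space2_iff)
  qed
  moreover have "Measurable.pred (\<G> t) (\<lambda>\<omega>. nearly_meet t (\<lambda>s. Y (Suc k) s \<omega>) (\<lambda>s. Z k s \<omega>))
      \<longleftrightarrow> Measurable.pred (\<G> t) (\<lambda>\<omega>. meeting_time k \<omega> \<le> t)"
  proof (rule measurable_cong)
    fix \<omega> assume "\<omega> \<in> space (\<G> t)"
    then have "\<omega> \<in> space \<Omega>" by (simp only: space_\<G>)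
    note R = Y_in_class[OF k this] Z_in_class[OF Suc_lessD[OF k] this]
    show "nearly_meet t (\<lambda>s. Y (Suc k) s \<omega>) (\<lambda>s. Z k s \<omega>) = (meeting_time k \<omega> \<le> t)"
      unfolding meeting_time_def nearly_meet_iff[OF R t] first_meeting_le_iff[OF R t(2)] by (rule refl)
  qed
  ultimately show ?thesis by (simp only:)
qed

lemma measurable_min_meeting_time:
  assumes k: "Suc k < n" and t: "t \<le> T"
  shows "(\<lambda>\<omega>. min (meeting_time k \<omega>) t) \<in> borel_measurable (\<G> t)"
  by (rule measurable_min_time[OF meeting_time_nonneg[OF k] meeting_time_measurable[OF k] t])

lemma observed_time_meeting:
  assumes k: "Suc k < n"
  shows "observed_time (\<lambda>\<omega>. min (meeting_time k \<omega>) T)"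
  unfolding observed_time_def
proof (intro conjI ballI)
  fix \<omega> assume "\<omega> \<in> space \<Omega>"
  then show "0 \<le> min (meeting_time k \<omega>) T" using meeting_time_nonneg[OF k] T_pos by simp
  show "min (meeting_time k \<omega>) T \<le> T" by (rule min.cobounded2)
next
  fix t assume t: "t \<in> {0..T}"
  show "Measurable.pred (\<G> t) (\<lambda>\<omega>. min (meeting_time k \<omega>) T \<le> t)"
  proof (cases "t = T")
    case True
    then show ?thesis by simp
  next
    case False
    then have eq: "(\<lambda>\<omega>. min (meeting_time k \<omega>) T \<le> t) = (\<lambda>\<omega>. meeting_time k \<omega> \<le> t)"
      using t by (simp add: min_le_iff_disj)
    show ?thesis unfolding eq using t by (intro meeting_time_measurable[OF k]) simp_all
  qed
qed

text \<open>
  On \<open>\<sigma> \<le> t\<close>, comparing the meeting time with \<open>\<sigma>\<close> amounts to comparing both after truncation at \<open>t\<close>,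
  and the truncated times are measurable with respect to the past at \<open>t\<close>.
\<close>
lemma known_at_met_before:
  assumes k: "Suc k < n" and \<sigma>: "observed_time \<sigma>"
  shows "known_at \<sigma> (\<lambda>\<omega>. of_bool (meeting_time k \<omega> \<le> \<sigma> \<omega>))"
  unfolding known_at_def
proof (intro conjI exI ballI)
  show "\<bar>of_bool (meeting_time k \<omega> \<le> \<sigma> \<omega>) :: real\<bar> \<le> 1" for \<omega> by simp
  fix t assume "t \<in> {0..T}"
  then have t: "0 \<le> t" "t \<le> T" by simp_all
  note p1 = observed_timeD(3)[OF \<sigma> t] and p2 = meeting_time_measurable[OF k t]
  have p3: "Measurable.pred (\<G> t) (\<lambda>\<omega>. min (meeting_time k \<omega>) t \<le> min (\<sigma> \<omega>) t)"
    using measurable_min_meeting_time[OF k t(2)] measurable_observed_min[OF \<sigma> t(2)]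
    by (rule borel_measurable_pred_le)
  have "(\<lambda>\<omega>. of_bool (\<sigma> \<omega> \<le> t \<and> meeting_time k \<omega> \<le> t \<and> min (meeting_time k \<omega>) t \<le> min (\<sigma> \<omega>) t) :: real)
      \<in> borel_measurable (\<G> t)"
    by (intro borel_measurable_of_bool_pred pred_intros_logic p1 p2 p3)
  moreover have "(\<lambda>\<omega>. of_bool (\<sigma> \<omega> \<le> t \<and> meeting_time k \<omega> \<le> t \<and> min (meeting_time k \<omega>) t \<le> min (\<sigma> \<omega>) t))
      = (\<lambda>\<omega>. of_bool (\<sigma> \<omega> \<le> t) * of_bool (meeting_time k \<omega> \<le> \<sigma> \<omega>) :: real)"
    unfolding of_bool_conj[symmetric] by (intro ext arg_cong[where f = of_bool]) linarith
  ultimately show "(\<lambda>\<omega>. of_bool (\<sigma> \<omega> \<le> t) * of_bool (meeting_time k \<omega> \<le> \<sigma> \<omega>) :: real)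
      \<in> borel_measurable (\<G> t)" by (simp only:)
qed

text \<open>
  If the meeting comes after \<open>\<sigma>\<close> and by time \<open>t\<close>, then also \<open>\<sigma> \<le> t\<close>, so what is known at \<open>\<sigma>\<close> belongs
  to the past at \<open>t\<close>.
\<close>
lemma known_at_meeting:
  assumes k: "Suc k < n" and \<sigma>: "observed_time \<sigma>" and f: "known_at \<sigma> f"
  shows "known_at (\<lambda>\<omega>. min (meeting_time k \<omega>) T)
    (\<lambda>\<omega>. of_bool (\<sigma> \<omega> < meeting_time k \<omega> \<and> meeting_time k \<omega> \<le> T) * f \<omega>)"
    (is "known_at ?\<rho> ?g")
  unfolding known_at_def
proof (intro conjI ballI)
  obtain C where C: "\<And>\<omega>. \<omega>\<in>space \<Omega> \<Longrightarrow> \<bar>f \<omega>\<bar> \<le> C" using f unfolding known_at_def by blast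
  have "\<bar>?g \<omega>\<bar> \<le> C" if "\<omega> \<in> space \<Omega>" for \<omega>
    using C[OF that] abs_ge_zero[of "f \<omega>"] by (simp add: of_bool_def del: abs_ge_zero)
  then show "\<exists>C. \<forall>\<omega>\<in>space \<Omega>. \<bar>?g \<omega>\<bar> \<le> C" by blast
  fix t assume "t \<in> {0..T}"
  then have t: "0 \<le> t" "t \<le> T" by simp_all
  have p: "Measurable.pred (\<G> t) (\<lambda>\<omega>. min (\<sigma> \<omega>) t < min (meeting_time k \<omega>) t)"
    using measurable_observed_min[OF \<sigma> t(2)] measurable_min_meeting_time[OF k t(2)]
    by (rule borel_measurable_pred_less)
  have "(\<lambda>\<omega>. of_bool (meeting_time k \<omega> \<le> t \<and> min (\<sigma> \<omega>) t < min (meeting_time k \<omega>) t)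
        * (of_bool (\<sigma> \<omega> \<le> t) * f \<omega>)) \<in> borel_measurable (\<G> t)"
    by (rule borel_measurable_times[OF _ known_atD[OF f t]])
      (intro borel_measurable_of_bool_pred pred_intros_logic meeting_time_measurable[OF k t] p)
  moreover have "of_bool (meeting_time k \<omega> \<le> t \<and> min (\<sigma> \<omega>) t < min (meeting_time k \<omega>) t) * (of_bool (\<sigma> \<omega> \<le> t) * f \<omega>)
      = of_bool (?\<rho> \<omega> \<le> t) * ?g \<omega>" for \<omega>
  proof -
    have "(meeting_time k \<omega> \<le> t \<and> min (\<sigma> \<omega>) t < min (meeting_time k \<omega>) t \<and> \<sigma> \<omega> \<le> t)
        \<longleftrightarrow> (?\<rho> \<omega> \<le> t \<and> \<sigma> \<omega> < meeting_time k \<omega> \<and> meeting_time k \<omega> \<le> T)"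
      using t by linarith
    then show ?thesis by (simp only: mult.assoc[symmetric] of_bool_conj[symmetric] conj_assoc)
  qed
  ultimately show "(\<lambda>\<omega>. of_bool (?\<rho> \<omega> \<le> t) * ?g \<omega>) \<in> borel_measurable (\<G> t)" by (simp only:)
qed

section \<open>Fluctuations of coalescing particles\<close>

text \<open>
  The matrices halfway through the replacement of rows: the particles below particle \<open>k\<close> still
  contribute their final positions, those above it have been replaced by rows \<open>q\<close>.
\<close>
definition hybrid :: "nat \<Rightarrow> (nat \<Rightarrow> 'w) \<Rightarrow> (nat \<Rightarrow> real) \<Rightarrow> (nat \<Rightarrow> nat \<Rightarrow> real) \<Rightarrow> nat \<Rightarrow> nat \<Rightarrow> real" where
  "hybrid k \<omega> u q i j =
     (if i < k then of_bool (Z i T \<omega> \<le> y j) - of_bool (i < j) else if i = k then u j else q i j)"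

lemma hybrid_linear:
  assumes k: "k < n"
  shows "rows_det n (hybrid k \<omega> (\<lambda>j. u j - v j + w j) q)
    = rows_det n (hybrid k \<omega> u q) - rows_det n (hybrid k \<omega> v q) + rows_det n (hybrid k \<omega> w q)"
proof -
  have "rows_det n (hybrid k \<omega> (\<lambda>j. u j - v j + w j) q)
      = - 1 * rows_det n (hybrid k \<omega> v q) + rows_det n (hybrid k \<omega> (\<lambda>j. u j + w j) q)"
    by (rule rows_det_linear[OF k]) (auto simp: hybrid_def)
  also have "rows_det n (hybrid k \<omega> (\<lambda>j. u j + w j) q)
      = 1 * rows_det n (hybrid k \<omega> u q) + rows_det n (hybrid k \<omega> w q)"
    by (rule rows_det_linear[OF k]) (auto simp: hybrid_def)
  finally show ?thesis by simp
qed

text \<open>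
  If particle \<open>k + 1\<close> has merged with particle \<open>k\<close>, its fluctuation in row \<open>k + 1\<close> becomes a fluctuation
  of particle \<open>k\<close> in row \<open>k\<close>, and the new row \<open>k + 1\<close> contains no final position.
\<close>
lemma hybrid_merge:
  assumes k: "Suc k < n"
  shows "rows_det n (hybrid (Suc k) \<omega> (\<lambda>j. of_bool (Z k T \<omega> \<le> y j) - g j) q)
    = rows_det n (hybrid k \<omega> (\<lambda>j. of_bool (Z k T \<omega> \<le> y j) - g j) (q(Suc k := (\<lambda>j. of_bool (k < j) - g j))))"
  by (rule rows_det_wedge[of k "Suc k"]) (use k in \<open>auto simp: hybrid_def\<close>)

lemma Z_independent: "i < k \<Longrightarrow> Z i t (\<omega> (k := a)) = Z i t \<omega>"
  unfolding Z_def by (rule coalesced_cong) (auto simp: Y_def fun_eq_iff)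

lemma bounded_measurable_Z: "i < n \<Longrightarrow> bounded_measurable \<Omega> (\<lambda>\<omega>. of_bool (Z i T \<omega> \<le> y j) - of_bool (i < j))"
  by (intro bounded_measurable_diff bounded_measurable_const measurable_end_value Z_measurable)
     (use T_pos in auto)

lemma bounded_measurable_hybrid:
  assumes "k < n" "\<And>j. j < n \<Longrightarrow> bounded_measurable \<Omega> (\<lambda>\<omega>. u \<omega> j)"
    and "\<And>i j. k < i \<Longrightarrow> i < n \<Longrightarrow> j < n \<Longrightarrow> bounded_measurable \<Omega> (\<lambda>\<omega>. q \<omega> i j)"
  shows "bounded_measurable \<Omega> (\<lambda>\<omega>. rows_det n (hybrid k \<omega> (u \<omega>) (q \<omega>)))"
proof (rule bounded_measurable_rows_det)
  fix i j assume ij: "i < n" "j < n"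
  consider "i < k" | "i = k" | "k < i" by linarith
  then show "bounded_measurable \<Omega> (\<lambda>\<omega>. hybrid k \<omega> (u \<omega>) (q \<omega>) i j)"
    unfolding hybrid_def using assms ij bounded_measurable_Z[of i j] by cases simp_all
qed

lemma bounded_measurable_fluctuation:
  assumes k: "k < n" and \<sigma>: "observed_time \<sigma>" and \<theta>: "known_at \<sigma> \<theta>"
    and q: "\<And>i j. k < i \<Longrightarrow> i < n \<Longrightarrow> j < n \<Longrightarrow> known_at \<sigma> (\<lambda>\<omega>. q \<omega> i j)"
    and W: "W T \<in> \<G> T \<rightarrow>\<^sub>M restrict_space borel S" "\<And>j. known_at \<sigma> (\<lambda>\<omega>. G (\<sigma> \<omega>) (W (\<sigma> \<omega>) \<omega>) j)"
  shows "bounded_measurable \<Omega> (\<lambda>\<omega>. \<theta> \<omega> * rows_det n (hybrid k \<omega>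
      (\<lambda>j. of_bool (W T \<omega> \<le> y j) - G (\<sigma> \<omega>) (W (\<sigma> \<omega>) \<omega>) j) (q \<omega>)))"
proof (intro bounded_measurable_mult bounded_measurable_hybrid k bounded_measurable_diff)
  show "bounded_measurable \<Omega> \<theta>" by (rule known_at_bounded_measurable[OF \<sigma> \<theta>])
  show "bounded_measurable \<Omega> (\<lambda>\<omega>. of_bool (W T \<omega> \<le> y j))" for j by (rule measurable_end_value[OF W(1)])
  show "bounded_measurable \<Omega> (\<lambda>\<omega>. G (\<sigma> \<omega>) (W (\<sigma> \<omega>) \<omega>) j)" for j
    by (rule known_at_bounded_measurable[OF \<sigma> W(2)])
  show "bounded_measurable \<Omega> (\<lambda>\<omega>. q \<omega> i j)" if "k < i" "i < n" "j < n" for i j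
    by (rule known_at_bounded_measurable[OF \<sigma> q[OF that]])
qed

text \<open>
  A particle that does not coalesce: the rows above it are functions of other coordinates, and the rows
  below it are known at \<open>\<sigma>\<close>.
\<close>
lemma free_fluctuation:
  assumes k: "k < n" and \<sigma>: "observed_time \<sigma>" and \<theta>: "known_at \<sigma> \<theta>"
    and q: "\<And>i j. k < i \<Longrightarrow> i < n \<Longrightarrow> j < n \<Longrightarrow> known_at \<sigma> (\<lambda>\<omega>. q \<omega> i j)"
  shows "(\<integral>\<omega>. \<theta> \<omega> * rows_det n (hybrid k \<omega>
      (\<lambda>j. of_bool (Y k T \<omega> \<le> y j) - G (\<sigma> \<omega>) (Y k (\<sigma> \<omega>) \<omega>) j) (q \<omega>)) \<partial>\<Omega>) = 0"
proof -
  have upd: "hybrid k \<omega> u (q \<omega>) = (hybrid k \<omega> (\<lambda>_. 0) (q \<omega>))(k := u)" for \<omega> u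
    by (auto simp: hybrid_def fun_eq_iff)
  have "(\<integral>\<omega>. \<theta> \<omega> * rows_det n ((hybrid k \<omega> (\<lambda>_. 0) (q \<omega>))(k :=
      (\<lambda>j. of_bool (Y k T \<omega> \<le> y j) - G (\<sigma> \<omega>) (Y k (\<sigma> \<omega>) \<omega>) j))) \<partial>\<Omega>) = 0"
  proof (rule free_row_expectation_zero[OF k \<sigma> known_at_section_known[OF \<sigma> \<theta> k]])
    fix i j assume ij: "i < n" "j < n" "i \<noteq> k"
    show "section_known k \<sigma> (\<lambda>\<omega>. hybrid k \<omega> (\<lambda>_. 0) (q \<omega>) i j)"
    proof (cases "i < k")
      case True
      have "section_known k \<sigma> (\<lambda>\<omega>. of_bool (Z i T \<omega> \<le> y j) - of_bool (i < j))"
        by (rule section_known_free[OF bounded_measurable_Z[OF ij(1)]]) (simp only: Z_independent[OF True])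
      with True show ?thesis by (simp add: hybrid_def)
    next
      case False
      then have "k < i" using ij by simp
      then have "section_known k \<sigma> (\<lambda>\<omega>. q \<omega> i j)"
        using ij by (intro known_at_section_known[OF \<sigma> q k])
      with \<open>k < i\<close> show ?thesis by (simp add: hybrid_def)
    qed
  qed
  then show ?thesis unfolding upd[symmetric] .
qed

text \<open>
  By induction on \<open>k\<close>, for all stopping times at once: particle \<open>k + 1\<close> follows its driving path up to
  the meeting with particle \<open>k\<close>, and particle \<open>k\<close> afterwards. The fluctuation of the driving path is
  removed by the strong Markov property, and that of particle \<open>k\<close> by the induction hypothesis at the
  later of \<open>\<sigma>\<close> and the meeting time.
\<close>
lemma coalesced_fluctuation:
  assumes "k < n" and "observed_time \<sigma>" and "known_at \<sigma> \<theta>"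
    and "\<And>i j. k < i \<Longrightarrow> i < n \<Longrightarrow> j < n \<Longrightarrow> known_at \<sigma> (\<lambda>\<omega>. q \<omega> i j)"
  shows "(\<integral>\<omega>. \<theta> \<omega> * rows_det n (hybrid k \<omega>
      (\<lambda>j. of_bool (Z k T \<omega> \<le> y j) - G (\<sigma> \<omega>) (Z k (\<sigma> \<omega>) \<omega>) j) (q \<omega>)) \<partial>\<Omega>) = 0"
  using assms
proof (induction k arbitrary: \<sigma> \<theta> q)
  case 0
  have "Z 0 t \<omega> = Y 0 t \<omega>" for t \<omega> by (simp add: Z_def)
  with free_fluctuation[OF 0] show ?case by simp
next
  case (Suc k)
  interpret P: prob_space \<Omega> by (rule prob_space_\<Omega>)
  note k = \<open>Suc k < n\<close> and \<sigma> = \<open>observed_time \<sigma>\<close> and \<theta> = \<open>known_at \<sigma> \<theta>\<close>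
  have q: "known_at \<sigma> (\<lambda>\<omega>. q \<omega> i j)" if "Suc k < i" "i < n" "j < n" for i j
    using Suc.prems(4)[OF that] .
  have k': "k < n" using k by simp
  define \<rho> where "\<rho> \<omega> = min (meeting_time k \<omega>) T" for \<omega>
  have \<rho>: "observed_time \<rho>" unfolding \<rho>_def[abs_def] by (rule observed_time_meeting[OF k])
  define m where "m \<omega> = (of_bool (meeting_time k \<omega> \<le> \<sigma> \<omega>) :: real)" for \<omega>
  have m: "known_at \<sigma> m" unfolding m_def[abs_def] by (rule known_at_met_before[OF k \<sigma>])
  define l where "l \<omega> = (of_bool (\<sigma> \<omega> < meeting_time k \<omega> \<and> meeting_time k \<omega> \<le> T) :: real)" for \<omega>
  have l: "known_at \<rho> (\<lambda>\<omega>. l \<omega> * f \<omega>)" if "known_at \<sigma> f" for f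
    unfolding l_def \<rho>_def by (rule known_at_meeting[OF k \<sigma> that])
  let ?a = "\<lambda>z j. of_bool (z \<le> y j) :: real"
  let ?fl = "\<lambda>W \<tau> \<omega> j. ?a (W T \<omega>) j - G (\<tau> \<omega>) (W (\<tau> \<omega>) \<omega>) j"
  \<comment> \<open>\<open>D1 - D2 + D3\<close> belongs to a meeting after \<open>\<sigma>\<close> or none, \<open>D4\<close> to a meeting before \<open>\<sigma>\<close>. \<open>D1\<close> and
    \<open>D2\<close> contain the driving path from \<open>\<sigma>\<close> and from the meeting on, \<open>D3\<close> and \<open>D4\<close> particle \<open>k\<close>. The
    factor \<open>l\<close> in \<open>q2\<close> makes rows known at \<open>\<sigma>\<close> also known at \<open>\<rho>\<close>.\<close>
  define \<theta>1 where "\<theta>1 \<omega> = \<theta> \<omega> * (1 - m \<omega>)" for \<omega>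
  define \<theta>2 where "\<theta>2 \<omega> = l \<omega> * \<theta> \<omega>" for \<omega>
  define \<theta>3 where "\<theta>3 \<omega> = \<theta> \<omega> * m \<omega>" for \<omega>
  define q2 where "q2 \<omega> i j = l \<omega> * q \<omega> i j" for \<omega> i j
  define q3 where "q3 \<omega> = (q2 \<omega>)(Suc k := (\<lambda>j. of_bool (k < j) - G (\<rho> \<omega>) (Z k (\<rho> \<omega>) \<omega>) j))" for \<omega>
  define q4 where "q4 \<omega> = (q \<omega>)(Suc k := (\<lambda>j. of_bool (k < j) - G (\<sigma> \<omega>) (Z k (\<sigma> \<omega>) \<omega>) j))" for \<omega>
  have \<theta>1: "known_at \<sigma> \<theta>1" unfolding \<theta>1_def[abs_def] by (intro known_at_mult known_at_diff known_at_const \<theta> m \<sigma>)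
  have \<theta>2: "known_at \<rho> \<theta>2" unfolding \<theta>2_def[abs_def] by (rule l[OF \<theta>])
  have \<theta>3: "known_at \<sigma> \<theta>3" unfolding \<theta>3_def[abs_def] by (intro known_at_mult \<theta> m)
  have q2: "known_at \<rho> (\<lambda>\<omega>. q2 \<omega> i j)" if "Suc k < i" "i < n" "j < n" for i j
    unfolding q2_def by (rule l[OF q[OF that]])
  have q3: "known_at \<rho> (\<lambda>\<omega>. q3 \<omega> i j)" if "k < i" "i < n" "j < n" for i j
  proof (cases "i = Suc k")
    case True
    show ?thesis
      unfolding q3_def True fun_upd_same by (intro known_at_diff known_at_const known_at_GZ k' \<rho>)
  next
    case False
    then show ?thesis using q2[of i j] that unfolding q3_def by simp
  qed
  have q4: "known_at \<sigma> (\<lambda>\<omega>. q4 \<omega> i j)" if "k < i" "i < n" "j < n" for i j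
  proof (cases "i = Suc k")
    case True
    show ?thesis
      unfolding q4_def True fun_upd_same by (intro known_at_diff known_at_const known_at_GZ k' \<sigma>)
  next
    case False
    then show ?thesis using q[of i j] that unfolding q4_def by simp
  qed
  define D1 where "D1 \<omega> = \<theta>1 \<omega> * rows_det n (hybrid (Suc k) \<omega> (?fl (Y (Suc k)) \<sigma> \<omega>) (q \<omega>))" for \<omega>
  define D2 where "D2 \<omega> = \<theta>2 \<omega> * rows_det n (hybrid (Suc k) \<omega> (?fl (Y (Suc k)) \<rho> \<omega>) (q2 \<omega>))" for \<omega>
  define D3 where "D3 \<omega> = \<theta>2 \<omega> * rows_det n (hybrid k \<omega> (?fl (Z k) \<rho> \<omega>) (q3 \<omega>))" for \<omega>
  define D4 where "D4 \<omega> = \<theta>3 \<omega> * rows_det n (hybrid k \<omega> (?fl (Z k) \<sigma> \<omega>) (q4 \<omega>))" for \<omega>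
  have T0: "0 \<le> T" using T_pos by simp
  have b: "bounded_measurable \<Omega> D1" "bounded_measurable \<Omega> D2" "bounded_measurable \<Omega> D3" "bounded_measurable \<Omega> D4"
    unfolding D1_def[abs_def] D2_def[abs_def] D3_def[abs_def] D4_def[abs_def]
    by (intro bounded_measurable_fluctuation k k' \<sigma> \<rho> \<theta>1 \<theta>2 \<theta>3 q q2 q3 q4
        Y_measurable Z_measurable known_at_GY known_at_GZ T0 order_refl; assumption)+
  have "(\<integral>\<omega>. D1 \<omega> \<partial>\<Omega>) = 0" unfolding D1_def by (rule free_fluctuation[OF k \<sigma> \<theta>1 q])
  moreover have "(\<integral>\<omega>. D2 \<omega> \<partial>\<Omega>) = 0" unfolding D2_def by (rule free_fluctuation[OF k \<rho> \<theta>2 q2])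
  moreover have "(\<integral>\<omega>. D3 \<omega> \<partial>\<Omega>) = 0" unfolding D3_def by (rule Suc.IH[OF k' \<rho> \<theta>2 q3])
  moreover have "(\<integral>\<omega>. D4 \<omega> \<partial>\<Omega>) = 0" unfolding D4_def by (rule Suc.IH[OF k' \<sigma> \<theta>3 q4])
  moreover have "(\<integral>\<omega>. \<theta> \<omega> * rows_det n (hybrid (Suc k) \<omega> (?fl (Z (Suc k)) \<sigma> \<omega>) (q \<omega>)) \<partial>\<Omega>)
      = (\<integral>\<omega>. D1 \<omega> - D2 \<omega> + D3 \<omega> + D4 \<omega> \<partial>\<Omega>)"
  proof (rule Bochner_Integration.integral_cong[OF refl])
    fix \<omega> assume \<omega>: "\<omega> \<in> space \<Omega>"
    have \<sigma>T: "\<sigma> \<omega> \<le> T" by (rule observed_timeD(2)[OF \<sigma> \<omega>])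
    consider "meeting_time k \<omega> \<le> \<sigma> \<omega>" | "T < meeting_time k \<omega>"
      | "\<sigma> \<omega> < meeting_time k \<omega>" "meeting_time k \<omega> \<le> T" by linarith
    then show "\<theta> \<omega> * rows_det n (hybrid (Suc k) \<omega> (?fl (Z (Suc k)) \<sigma> \<omega>) (q \<omega>)) = D1 \<omega> - D2 \<omega> + D3 \<omega> + D4 \<omega>"
    proof cases
      case 1
      then have "m \<omega> = 1" "l \<omega> = 0" by (simp_all add: m_def l_def)
      moreover have "?fl (Z (Suc k)) \<sigma> \<omega> = ?fl (Z k) \<sigma> \<omega>"
        using 1 \<sigma>T by (simp add: Z_Suc[OF k \<omega>])
      ultimately show ?thesis
        unfolding D1_def D2_def D3_def D4_def \<theta>1_def \<theta>2_def \<theta>3_def q4_def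
        by (simp add: hybrid_merge[OF k])
    next
      case 2
      then have "m \<omega> = 0" "l \<omega> = 0" using \<sigma>T by (simp_all add: m_def l_def)
      moreover have "?fl (Z (Suc k)) \<sigma> \<omega> = ?fl (Y (Suc k)) \<sigma> \<omega>"
        using 2 \<sigma>T by (simp add: Z_Suc[OF k \<omega>])
      ultimately show ?thesis
        unfolding D1_def D2_def D3_def D4_def \<theta>1_def \<theta>2_def \<theta>3_def by simp
    next
      case 3
      then have ml: "m \<omega> = 0" "l \<omega> = 1" by (simp_all add: m_def l_def)
      have \<rho>m: "\<rho> \<omega> = meeting_time k \<omega>" using 3 by (simp add: \<rho>_def)
      have YZ: "Y (Suc k) (\<rho> \<omega>) \<omega> = Z k (\<rho> \<omega>) \<omega>"
        unfolding \<rho>m by (rule meeting_time_meets[OF k \<omega> 3(2)])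
      have fl: "?fl (Z (Suc k)) \<sigma> \<omega> = (\<lambda>j. ?fl (Y (Suc k)) \<sigma> \<omega> j - ?fl (Y (Suc k)) \<rho> \<omega> j + ?fl (Z k) \<rho> \<omega> j)"
        using 3 \<sigma>T by (simp add: Z_Suc[OF k \<omega>] YZ fun_eq_iff)
      have q2q: "q2 \<omega> = q \<omega>" by (simp add: q2_def ml fun_eq_iff)
      have "rows_det n (hybrid (Suc k) \<omega> (?fl (Z (Suc k)) \<sigma> \<omega>) (q \<omega>))
          = rows_det n (hybrid (Suc k) \<omega> (?fl (Y (Suc k)) \<sigma> \<omega>) (q \<omega>))
            - rows_det n (hybrid (Suc k) \<omega> (?fl (Y (Suc k)) \<rho> \<omega>) (q2 \<omega>))
            + rows_det n (hybrid k \<omega> (?fl (Z k) \<rho> \<omega>) (q3 \<omega>))"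
        unfolding fl q3_def q2q hybrid_linear[OF k] hybrid_merge[OF k] by (rule refl)
      then show ?thesis
        unfolding D1_def D2_def D3_def D4_def \<theta>1_def \<theta>2_def \<theta>3_def
        by (simp add: ml right_diff_distrib distrib_left)
    qed
  qed
  moreover have "(\<integral>\<omega>. D1 \<omega> - D2 \<omega> + D3 \<omega> + D4 \<omega> \<partial>\<Omega>)
      = (\<integral>\<omega>. D1 \<omega> \<partial>\<Omega>) - (\<integral>\<omega>. D2 \<omega> \<partial>\<Omega>) + (\<integral>\<omega>. D3 \<omega> \<partial>\<Omega>) + (\<integral>\<omega>. D4 \<omega> \<partial>\<Omega>)"
    using b[THEN P.integrable_bounded_measurable] by simp
  ultimately show ?case by simp
qed

section \<open>The determinant formula\<close>

text \<open>
  The rows are replaced one at a time; exchanging row \<open>k\<close> costs exactly the expectation in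
  \<open>coalesced_fluctuation\<close> for \<open>\<sigma> = 0\<close>.
\<close>
lemma expectation_coalesced_det:
  assumes start: "\<And>i. i < n \<Longrightarrow> AE \<omega> in M. X i 0 \<omega> = x i"
  shows "(\<integral>\<omega>. rows_det n (\<lambda>i j. of_bool (Z i T \<omega> \<le> y j) - of_bool (i < j)) \<partial>\<Omega>)
       = rows_det n (\<lambda>i j. G 0 (x i) j - of_bool (i < j))"
proof -
  interpret P: prob_space \<Omega> by (rule prob_space_\<Omega>)
  define c where "c i j = G 0 (x i) j - of_bool (i < j)" for i j
  \<comment> \<open>The first \<open>k\<close> rows contain final positions, the others have been replaced.\<close>
  define e where "e k \<omega> = rows_det n (\<lambda>i j. if i < k then of_bool (Z i T \<omega> \<le> y j) - of_bool (i < j) else c i j)"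
    for k \<omega>
  have T0: "0 \<le> T" using T_pos by simp
  have e_bounded: "bounded_measurable \<Omega> (e k)" if "k \<le> n" for k
    unfolding e_def[abs_def]
  proof (rule bounded_measurable_rows_det)
    fix i j assume "i < n" "j < n"
    then show "bounded_measurable \<Omega> (\<lambda>\<omega>. if i < k then of_bool (Z i T \<omega> \<le> y j) - of_bool (i < j) else c i j)"
      using bounded_measurable_Z[of i j] bounded_measurable_const[of \<Omega> "c i j"] by (cases "i < k") simp_all
  qed
  have step: "(\<integral>\<omega>. e (Suc k) \<omega> \<partial>\<Omega>) = (\<integral>\<omega>. e k \<omega> \<partial>\<Omega>)" if k: "k < n" for k
  proof -
    let ?D = "\<lambda>\<omega>. 1 * rows_det n (hybrid k \<omega> (\<lambda>j. of_bool (Z k T \<omega> \<le> y j) - G 0 (Z k 0 \<omega>) j) c)"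
    have \<sigma>: "observed_time (\<lambda>_. 0)" by (rule observed_time_const[OF order_refl T0])
    have zero: "(\<integral>\<omega>. ?D \<omega> \<partial>\<Omega>) = 0"
      by (rule coalesced_fluctuation[OF k \<sigma>, of "\<lambda>_. 1" "\<lambda>_. c"]) (rule known_at_const[OF \<sigma>])+
    have Db: "bounded_measurable \<Omega> ?D"
      by (rule bounded_measurable_fluctuation[OF k \<sigma>, of "\<lambda>_. 1" "\<lambda>_. c" "Z k"])
        (rule known_at_const[OF \<sigma>] Z_measurable[OF k T0 order_refl order_refl] known_at_GZ[OF k \<sigma>])+
    have "AE \<omega> in \<Omega>. X k 0 (\<omega> k) = x k"
      by (rule AE_PiM_component[where M = "\<lambda>_. M", OF prob_space_axioms _ start[OF k]]) (use k in simp)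
    then have "AE \<omega> in \<Omega>. e (Suc k) \<omega> = ?D \<omega> + e k \<omega>"
    proof eventually_elim
      case (elim \<omega>)
      then have "Z k 0 \<omega> = x k" by (simp add: Z_def coalesced_zero Y_def)
      then show ?case
        unfolding e_def by (intro rows_det_linear[OF k]) (auto simp: hybrid_def c_def)
    qed
    then have "(\<integral>\<omega>. e (Suc k) \<omega> \<partial>\<Omega>) = (\<integral>\<omega>. ?D \<omega> + e k \<omega> \<partial>\<Omega>)"
      using e_bounded[of k] e_bounded[of "Suc k"] Db k
      unfolding bounded_measurable_def by (intro integral_cong_AE borel_measurable_add) simp_all
    also have "\<dots> = (\<integral>\<omega>. ?D \<omega> \<partial>\<Omega>) + (\<integral>\<omega>. e k \<omega> \<partial>\<Omega>)"
      using k by (intro Bochner_Integration.integral_add P.integrable_bounded_measurable Db e_bounded) simp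
    finally show ?thesis unfolding zero by simp
  qed
  have "(\<integral>\<omega>. e k \<omega> \<partial>\<Omega>) = (\<integral>\<omega>. e 0 \<omega> \<partial>\<Omega>)" if "k \<le> n" for k
    using that by (induction k) (simp_all add: step)
  from this[of n] have "(\<integral>\<omega>. e n \<omega> \<partial>\<Omega>) = (\<integral>\<omega>. e 0 \<omega> \<partial>\<Omega>)" by simp
  moreover have "e 0 \<omega> = rows_det n c" for \<omega> unfolding e_def by simp
  moreover have "e n \<omega> = rows_det n (\<lambda>i j. of_bool (Z i T \<omega> \<le> y j) - of_bool (i < j))" for \<omega>
    unfolding e_def by (rule rows_det_cong) simp
  ultimately show ?thesis by (simp add: P.prob_space c_def[abs_def])
qed

text \<open>
  The determinant in final positions is transferred to the product space, where its expectation is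
  known. Back on the given space it is the indicator of the event; the order of the particles, which
  this uses, is an almost sure property there and would not be meaningful for separate coordinates.
\<close>
lemma coalesced_probability:
  assumes n: "0 < n"
    and ind: "indep_vars (\<lambda>_. Pi\<^sub>M {0..T} (\<lambda>_. restrict_space borel S)) (\<lambda>i \<omega>. \<lambda>t\<in>{0..T}. X i t \<omega>) {..<n}"
    and start: "\<And>i. i < n \<Longrightarrow> AE \<omega> in M. X i 0 \<omega> = x i"
    and ord: "\<And>i j. i < n \<Longrightarrow> j < n \<Longrightarrow> AE \<omega> in M. order_changes_only_by_meeting T (\<lambda>t. X i t \<omega>) (\<lambda>t. X j t \<omega>)"
    and x: "\<And>i j. i < j \<Longrightarrow> j < n \<Longrightarrow> x i < x j" and y: "\<And>i j. i \<le> j \<Longrightarrow> j < n \<Longrightarrow> y i \<le> y j"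
  shows "prob {\<omega> \<in> space M. \<forall>i<n. coalesced (\<lambda>j t. X j t \<omega>) i T \<le> y i}
       = rows_det n (\<lambda>i j. G 0 (x i) j - of_bool (i < j))"
proof -
  let ?P = "Pi\<^sub>M {0..T} (\<lambda>_. restrict_space borel S)"
  let ?f = "\<lambda>i \<omega>. \<lambda>t\<in>{0..T}. X i t \<omega>"
  let ?V = "\<lambda>i \<omega>. coalesced (\<lambda>j t. X j t \<omega>) i T"
  define g where "g w = rows_det n (\<lambda>i j. of_bool (approx_coalesced w i T \<le> y j) - of_bool (i < j))"
    for w :: "nat \<Rightarrow> real \<Rightarrow> real"
  have T0: "0 \<le> T" using T_pos by simp
  have gm: "g \<in> borel_measurable (Pi\<^sub>M {..<n} (\<lambda>_. ?P))"
  proof -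
    have "(\<lambda>w. approx_coalesced w i T) \<in> borel_measurable (Pi\<^sub>M {..<n} (\<lambda>_. ?P))" if i: "i < n" for i
    proof (rule measurable_approx_coalesced[where V = "\<lambda>j s w. w j s", OF _ T0])
      fix j s assume "j \<le> i" "0 \<le> s" "s \<le> T"
      then have js: "j \<in> {..<n}" "s \<in> {0..T}" using i by auto
      have "(\<lambda>w. w j s) \<in> Pi\<^sub>M {..<n} (\<lambda>_. ?P) \<rightarrow>\<^sub>M restrict_space borel S"
        by (rule measurable_compose[OF measurable_component_singleton[OF js(1)] measurable_component_singleton[OF js(2)]])
      then show "(\<lambda>w. w j s) \<in> borel_measurable (Pi\<^sub>M {..<n} (\<lambda>_. ?P))"
        by (simp add: measurable_restrict_space2_iff)
    qed
    then have "bounded_measurable (Pi\<^sub>M {..<n} (\<lambda>_. ?P)) g"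
      unfolding g_def[abs_def]
      by (intro bounded_measurable_rows_det bounded_measurable_diff bounded_measurable_const
          bounded_measurable_of_bool borel_measurable_pred_le borel_measurable_const) blast
    then show ?thesis unfolding bounded_measurable_def by blast
  qed
  have reg: "approx_coalesced (\<lambda>i\<in>{..<n}. \<lambda>t\<in>{0..T}. w i t) i T = coalesced w i T"
    if "i < n" "\<And>j. j < n \<Longrightarrow> w j \<in> R" for i and w :: "nat \<Rightarrow> real \<Rightarrow> real"
  proof -
    have "approx_coalesced (\<lambda>i\<in>{..<n}. \<lambda>t\<in>{0..T}. w i t) i T = approx_coalesced w i T"
      using that(1) by (intro approx_coalesced_cong[OF _ T0]) simp
    also have "\<dots> = coalesced w i T" using that by (intro approx_coalesced_eq T0) simp_all
    finally show ?thesis .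
  qed
  have "(\<integral>\<omega>. g (\<lambda>i\<in>{..<n}. ?f i \<omega>) \<partial>M) = (\<integral>\<omega>. g (\<lambda>i\<in>{..<n}. ?f i (\<omega> i)) \<partial>\<Omega>)"
    by (rule indep_vars_integral_product_copy[OF _ _ ind gm]) (use n in auto)
  also have "\<dots> = (\<integral>\<omega>. rows_det n (\<lambda>i j. of_bool (Z i T \<omega> \<le> y j) - of_bool (i < j)) \<partial>\<Omega>)"
  proof (rule Bochner_Integration.integral_cong[OF refl])
    fix \<omega> assume \<omega>: "\<omega> \<in> space \<Omega>"
    have "approx_coalesced (\<lambda>i\<in>{..<n}. ?f i (\<omega> i)) i T = Z i T \<omega>" if "i < n" for i
      using reg[OF that, of "\<lambda>j t. Y j t \<omega>"] Y_in_class[OF _ \<omega>] by (simp add: Z_def Y_def)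
    then show "g (\<lambda>i\<in>{..<n}. ?f i (\<omega> i)) = rows_det n (\<lambda>i j. of_bool (Z i T \<omega> \<le> y j) - of_bool (i < j))"
      unfolding g_def by (intro rows_det_cong) (simp only:)
  qed
  also have "\<dots> = rows_det n (\<lambda>i j. G 0 (x i) j - of_bool (i < j))"
    by (rule expectation_coalesced_det[OF start])
  finally have main: "(\<integral>\<omega>. g (\<lambda>i\<in>{..<n}. ?f i \<omega>) \<partial>M) = rows_det n (\<lambda>i j. G 0 (x i) j - of_bool (i < j))" .
  have Vm: "?V i \<in> borel_measurable M" if i: "i < n" for i
  proof -
    have "(\<lambda>\<omega>. approx_coalesced (\<lambda>j s. X j s \<omega>) i T) \<in> borel_measurable M"
    proof (rule measurable_approx_coalesced[OF _ T0])
      fix j s assume "j \<le> i" "0 \<le> s" "s \<le> T"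
      then show "X j s \<in> borel_measurable M"
        using X_measurable[of j s] i by (simp add: measurable_restrict_space2_iff)
    qed
    moreover have "(\<lambda>\<omega>. approx_coalesced (\<lambda>j s. X j s \<omega>) i T) \<in> borel_measurable M \<longleftrightarrow> ?V i \<in> borel_measurable M"
    proof (rule measurable_cong)
      fix \<omega> assume "\<omega> \<in> space M"
      then show "approx_coalesced (\<lambda>j s. X j s \<omega>) i T = ?V i \<omega>"
        using i regular by (intro approx_coalesced_eq T0) auto
    qed
    ultimately show ?thesis by (simp only:)
  qed
  have ev: "Measurable.pred M (\<lambda>\<omega>. \<forall>i\<in>{..<n}. ?V i \<omega> \<le> y i)"
    by (intro pred_intros_finite borel_measurable_pred_le borel_measurable_const Vm) auto
  let ?A = "{\<omega> \<in> space M. \<forall>i<n. ?V i \<omega> \<le> y i}"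
  have A: "?A \<in> events" using ev unfolding pred_def by (simp only: Ball_def lessThan_iff)
  have "AE \<omega> in M. \<forall>i\<in>{..<n}. X i 0 \<omega> = x i"
    using start by (intro AE_finite_allI) auto
  moreover have "AE \<omega> in M. \<forall>i\<in>{..<n}. \<forall>j\<in>{..<n}. order_changes_only_by_meeting T (\<lambda>t. X i t \<omega>) (\<lambda>t. X j t \<omega>)"
    using ord by (intro AE_finite_allI) auto
  ultimately have "AE \<omega> in M. g (\<lambda>i\<in>{..<n}. ?f i \<omega>) = indicator ?A \<omega>"
    using AE_space
  proof eventually_elim
    case (elim \<omega>)
    have R: "(\<lambda>t. X j t \<omega>) \<in> R" if "j < n" for j using regular[OF that elim(3)] .
    have "approx_coalesced (\<lambda>i\<in>{..<n}. ?f i \<omega>) i T = ?V i \<omega>" if "i < n" for i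
      using reg[OF that, of "\<lambda>j t. X j t \<omega>"] R by simp
    then have "g (\<lambda>i\<in>{..<n}. ?f i \<omega>) = rows_det n (\<lambda>i j. of_bool (?V i \<omega> \<le> y j) - of_bool (i < j))"
      unfolding g_def by (intro rows_det_cong) (simp only:)
    also have "\<dots> = of_bool (\<forall>i<n. ?V i \<omega> \<le> y i)"
    proof (rule rows_det_indicator[OF _ y])
      fix i j assume ij: "i \<le> j" "j < n"
      show "?V i \<omega> \<le> ?V j \<omega>"
        by (rule coalesced_ordered[OF R _ _ ij]) (use elim x in auto)
    qed
    also have "\<dots> = indicator ?A \<omega>" using elim(3) by (simp add: indicator_def)
    finally show ?case .
  qed
  then have "(\<integral>\<omega>. g (\<lambda>i\<in>{..<n}. ?f i \<omega>) \<partial>M) = (\<integral>\<omega>. indicator ?A \<omega> \<partial>M)"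
  proof (rule integral_cong_AE[rotated 2])
    have "(\<lambda>\<omega>. \<lambda>i\<in>{..<n}. ?f i \<omega>) \<in> M \<rightarrow>\<^sub>M Pi\<^sub>M {..<n} (\<lambda>_. ?P)"
      by (intro measurable_restrict X_measurable) auto
    from measurable_compose[OF this gm] show "(\<lambda>\<omega>. g (\<lambda>i\<in>{..<n}. ?f i \<omega>)) \<in> borel_measurable M" .
    show "(\<lambda>\<omega>. indicator ?A \<omega> :: real) \<in> borel_measurable M" by (rule borel_measurable_indicator[OF A])
  qed
  also have "\<dots> = prob (?A \<inter> space M)" by (rule Bochner_Integration.integral_indicator)
  also have "?A \<inter> space M = ?A" by blast
  finally show ?thesis using main by (simp only:)
qed

end

theorem theorem6p1:
  fixes M :: "'w measure"
    and T :: real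
    and S :: "real set"
    and \<kappa> :: "real \<Rightarrow> real \<Rightarrow> real \<Rightarrow> real measure"
    and n :: nat
    and x y :: "nat \<Rightarrow> real"
    and X :: "nat \<Rightarrow> real \<Rightarrow> 'w \<Rightarrow> real"
  assumes "prob_space M"
    and "0 < T"
    and "transition_function T S \<kappa>"
    and "\<forall>i<n. x i \<in> S" and "strict_mono_on {..<n} x"
    and "\<forall>i<n. y i \<in> S" and "mono_on {..<n} y"
    and "independent_copies M T S \<kappa> n x X"
    and "skip_free M T S n X"
  shows "measure M {\<omega> \<in> space M. \<forall>i<n. coalesced (\<lambda>j t. X j t \<omega>) i T \<le> y i}
       = Determinant.det (Matrix.mat n n
           (\<lambda>(i, j). one_particle_cdf T S \<kappa> (x i) (y j) - of_bool (i < j)))"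
proof (cases "n = 0")
  case True
  then show ?thesis using prob_space.prob_space[OF assms(1)] by (simp add: det_dim_zero)
next
  case False
  have n: "0 < n" using False by simp
  have markov: "strong_markov_process M T S \<kappa> (X k)" if "k < n" for k
    using assms(8) that unfolding independent_copies_def by blast
  have start: "AE \<omega> in M. X k 0 \<omega> = x k" if "k < n" for k
    using assms(8) that unfolding independent_copies_def by blast
  have ind: "prob_space.indep_vars M (\<lambda>_. Pi\<^sub>M {0..T} (\<lambda>_. restrict_space borel S))
      (\<lambda>i \<omega>. \<lambda>t\<in>{0..T}. X i t \<omega>) {..<n}"
    using assms(8) unfolding independent_copies_def by blast
  have x: "x i < x j" if "i < j" "j < n" for i j
    using strict_mono_onD[OF assms(5), of i j] that by simp
  have y: "y i \<le> y j" if "i \<le> j" "j < n" for i j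
    using mono_onD[OF assms(7), of i j] that by simp
  have "\<exists>R. path_class T R \<and> (\<forall>k<n. \<forall>\<omega>\<in>space M. (\<lambda>t. X k t \<omega>) \<in> R) \<and>
      (\<forall>i<n. \<forall>j<n. AE \<omega> in M. order_changes_only_by_meeting T (\<lambda>t. X i t \<omega>) (\<lambda>t. X j t \<omega>))"
    using assms(9) unfolding skip_free_def
  proof (elim disjE conjE)
    assume c: "\<forall>i<n. \<forall>\<omega>\<in>space M. continuous_on {0..T} (\<lambda>t. X i t \<omega>)"
    have "AE \<omega> in M. order_changes_only_by_meeting T (\<lambda>t. X i t \<omega>) (\<lambda>t. X j t \<omega>)" if "i < n" "j < n" for i j
      using c that by (intro AE_I2 continuous_order_changes_only_by_meeting) blast+
    with c path_class_continuous[OF assms(2)] show ?thesis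
      by (intro exI[of _ "{w. continuous_on {0..T} w}"]) simp
  next
    assume c: "\<forall>i<n. \<forall>\<omega>\<in>space M. neighbour_jump_path T S (\<lambda>t. X i t \<omega>)"
      and o: "\<forall>i<n. \<forall>j<n. AE \<omega> in M. order_changes_only_by_meeting T (\<lambda>t. X i t \<omega>) (\<lambda>t. X j t \<omega>)"
    have "\<forall>k<n. \<forall>\<omega>\<in>space M. (\<lambda>t. X k t \<omega>) \<in> step_paths T"
      using c neighbour_jump_path_step[OF _ assms(2)] by blast
    with o path_class_step[OF assms(2)] show ?thesis by blast
  qed
  then obtain R where R: "path_class T R" "\<And>k \<omega>. k < n \<Longrightarrow> \<omega> \<in> space M \<Longrightarrow> (\<lambda>t. X k t \<omega>) \<in> R"
    and ord: "\<And>i j. i < n \<Longrightarrow> j < n \<Longrightarrow> AE \<omega> in M. order_changes_only_by_meeting T (\<lambda>t. X i t \<omega>) (\<lambda>t. X j t \<omega>)"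
    by blast
  have loc: "independent_particles M T R S \<kappa> n X"
    unfolding independent_particles_def independent_particles_axioms_def
    using assms(1,3) R markov by simp
  show ?thesis
    using independent_particles.coalesced_probability[OF loc n ind start ord x y]
    unfolding rows_det_def independent_particles.G_def[OF loc] one_particle_cdf_def by simp
qed

end
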